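(* Let $A$ be a quasinormed operator ideal and let $X$ be a Banach space for which the set of finite rank operators is dense in the space $A(X)$. Suppose that the standard functional $\operatorname{trace}$ is bounded on the subspace of all finite rank operators of $A(X)$. Then the function $u\mapsto\det(1-u)$ admits a continuous extension (with respect to the $A$-quasinorm) from the subspace of all finite rank operators of $A(X)$ to the whole space $A(X)$.
   Context: Banach spaces are complex. An operator ideal $A$ is a class of bounded operators with components $A(X,Y)\subset L(X,Y)$ such that the identity $1_K$ of the one-dimensional space $K$ is in $A$, each $A(X,Y)$ is a linear subspace, and $TUS\in A(Z,W)$ for $S\in L(Z,X)$, $U\in A(X,Y)$, $T\in L(Y,W)$. It is quasinormed if it carries a function $\|\cdot\|_A$ that is a quasinorm on each component (positive definite, homogeneous, with $\|U+V\|_A\le C(\|U\|_A+\|V\|_A)$ for some constant $C$), with $\|1_K\|_A=1$ and $\|TUS\|_A\le\|T\|\,\|U\|_A\,\|S\|$. Write $A(X)=A(X,X)$. For a finite rank operator $u=\sum_{k=1}^N x_k'\otimes x_k$ on $X$, $\operatorname{trace}u=\sum_{k=1}^N x_k'(x_k)$ and $\det(1-u)=\prod_j(1-\mu_j)$, where $(\mu_j)$ is the complete system of eigenvalues of $u$, counted with multiplicity. Boundedness of the trace means $|\operatorname{trace}u|\le b\|u\|_A$ for some constant $b$ and all finite rank $u\in A(X)$. *)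

theory Defs
  imports Complex_Main
begin

text \<open>
  An operator ideal is a class of operators between all Banach spaces. As HOL cannot quantify over
  types inside a proposition, the Banach spaces are objects of one type: an arbitrary complex vector
  space, given by a type \<open>'u\<close> and a scalar multiplication \<open>s\<close>, serves as universe, and a Banach space
  is a linear subspace of it together with a complete norm of its own. The norm is not inherited
  from the universe, and the subspace may be the whole universe; so every Banach space, and every
  set of Banach spaces, is represented for a suitable universe.
\<close>

record 'u nspace =
  pts :: "'u set"
  nrm :: "'u \<Rightarrow> real"

definition banach_space :: "(complex \<Rightarrow> 'u \<Rightarrow> 'u::ab_group_add) \<Rightarrow> 'u nspace \<Rightarrow> bool" where
  "banach_space s X \<longleftrightarrow>
     module.subspace s (pts X) \<and>
     (\<forall>x\<in>pts X. 0 \<le> nrm X x) \<and>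
     (\<forall>x\<in>pts X. nrm X x = 0 \<longleftrightarrow> x = 0) \<and>
     (\<forall>c. \<forall>x\<in>pts X. nrm X (s c x) = cmod c * nrm X x) \<and>
     (\<forall>x\<in>pts X. \<forall>y\<in>pts X. nrm X (x + y) \<le> nrm X x + nrm X y) \<and>
     (\<forall>f::nat \<Rightarrow> 'u. (\<forall>n. f n \<in> pts X) \<and>
        (\<forall>e>0. \<exists>M. \<forall>m\<ge>M. \<forall>n\<ge>M. nrm X (f m - f n) < e) \<longrightarrow>
        (\<exists>l\<in>pts X. (\<lambda>n. nrm X (f n - l)) \<longlonglongrightarrow> 0))"

text \<open>
  Operators and functionals are functions on the whole universe that vanish outside their domain.
  So equality of operators is equality of functions, linear combinations are pointwise, and
  composition is \<open>\<circ>\<close>.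
\<close>

definition bounded_ops ::
    "(complex \<Rightarrow> 'u \<Rightarrow> 'u::ab_group_add) \<Rightarrow> 'u nspace \<Rightarrow> 'u nspace \<Rightarrow> ('u \<Rightarrow> 'u) set" where
  "bounded_ops s X Y = {T.
     (\<forall>x\<in>pts X. T x \<in> pts Y) \<and>
     (\<forall>x. x \<notin> pts X \<longrightarrow> T x = 0) \<and>
     (\<forall>x\<in>pts X. \<forall>y\<in>pts X. T (x + y) = T x + T y) \<and>
     (\<forall>c. \<forall>x\<in>pts X. T (s c x) = s c (T x)) \<and>
     (\<exists>B. \<forall>x\<in>pts X. nrm Y (T x) \<le> B * nrm X x)}"

definition dual :: "(complex \<Rightarrow> 'u \<Rightarrow> 'u::ab_group_add) \<Rightarrow> 'u nspace \<Rightarrow> ('u \<Rightarrow> complex) set" where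
  "dual s X = {\<phi>.
     (\<forall>x. x \<notin> pts X \<longrightarrow> \<phi> x = 0) \<and>
     (\<forall>x\<in>pts X. \<forall>y\<in>pts X. \<phi> (x + y) = \<phi> x + \<phi> y) \<and>
     (\<forall>c. \<forall>x\<in>pts X. \<phi> (s c x) = c * \<phi> x) \<and>
     (\<exists>B. \<forall>x\<in>pts X. cmod (\<phi> x) \<le> B * nrm X x)}"

definition id_op :: "'u nspace \<Rightarrow> 'u \<Rightarrow> 'u::ab_group_add" where
  "id_op X = (\<lambda>x. if x \<in> pts X then x else 0)"

definition op_norm :: "'u nspace \<Rightarrow> 'u nspace \<Rightarrow> ('u \<Rightarrow> 'u) \<Rightarrow> real" where
  "op_norm X Y T = (SUP x\<in>{x\<in>pts X. nrm X x \<le> 1}. nrm Y (T x))"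

text \<open>
  The scalar field occurs in the universe as the one-dimensional Banach spaces, which are all
  isometrically isomorphic.
\<close>

locale operator_ideal = vector_space s
  for s :: "complex \<Rightarrow> 'u \<Rightarrow> 'u::ab_group_add" +
  fixes A :: "'u nspace \<Rightarrow> 'u nspace \<Rightarrow> ('u \<Rightarrow> 'u) set"
  assumes ideal_bounded:
      "\<lbrakk>banach_space s X; banach_space s Y\<rbrakk> \<Longrightarrow> A X Y \<subseteq> bounded_ops s X Y"
    and ideal_id:
      "\<lbrakk>banach_space s K; vector_space.dim s (pts K) = 1\<rbrakk> \<Longrightarrow> id_op K \<in> A K K"
    and ideal_zero:
      "\<lbrakk>banach_space s X; banach_space s Y\<rbrakk> \<Longrightarrow> (\<lambda>_. 0) \<in> A X Y"
    and ideal_add: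
      "\<lbrakk>banach_space s X; banach_space s Y; U \<in> A X Y; V \<in> A X Y\<rbrakk>
        \<Longrightarrow> (\<lambda>x. U x + V x) \<in> A X Y"
    and ideal_scale:
      "\<lbrakk>banach_space s X; banach_space s Y; U \<in> A X Y\<rbrakk> \<Longrightarrow> (\<lambda>x. s c (U x)) \<in> A X Y"
    and ideal_comp:
      "\<lbrakk>banach_space s Z; banach_space s X; banach_space s Y; banach_space s W;
        S \<in> bounded_ops s Z X; U \<in> A X Y; T \<in> bounded_ops s Y W\<rbrakk>
        \<Longrightarrow> T \<circ> U \<circ> S \<in> A Z W"

locale quasinormed_operator_ideal = operator_ideal s A
  for s :: "complex \<Rightarrow> 'u \<Rightarrow> 'u::ab_group_add"
    and A :: "'u nspace \<Rightarrow> 'u nspace \<Rightarrow> ('u \<Rightarrow> 'u) set" +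
  fixes q :: "'u nspace \<Rightarrow> 'u nspace \<Rightarrow> ('u \<Rightarrow> 'u) \<Rightarrow> real"
  assumes q_nonneg:
      "\<lbrakk>banach_space s X; banach_space s Y; U \<in> A X Y\<rbrakk> \<Longrightarrow> 0 \<le> q X Y U"
    and q_eq_0_iff:
      "\<lbrakk>banach_space s X; banach_space s Y; U \<in> A X Y\<rbrakk>
        \<Longrightarrow> q X Y U = 0 \<longleftrightarrow> U = (\<lambda>_. 0)"
    and q_scale:
      "\<lbrakk>banach_space s X; banach_space s Y; U \<in> A X Y\<rbrakk>
        \<Longrightarrow> q X Y (\<lambda>x. s c (U x)) = cmod c * q X Y U"
    and q_add:
      "\<lbrakk>banach_space s X; banach_space s Y\<rbrakk>
        \<Longrightarrow> \<exists>C. \<forall>U\<in>A X Y. \<forall>V\<in>A X Y. q X Y (\<lambda>x. U x + V x) \<le> C * (q X Y U + q X Y V)"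
    and q_id:
      "\<lbrakk>banach_space s K; vector_space.dim s (pts K) = 1\<rbrakk> \<Longrightarrow> q K K (id_op K) = 1"
    and q_comp:
      "\<lbrakk>banach_space s Z; banach_space s X; banach_space s Y; banach_space s W;
        S \<in> bounded_ops s Z X; U \<in> A X Y; T \<in> bounded_ops s Y W\<rbrakk>
        \<Longrightarrow> q Z W (T \<circ> U \<circ> S) \<le> op_norm Y W T * q X Y U * op_norm Z X S"

definition finite_rank_rep ::
    "(complex \<Rightarrow> 'u \<Rightarrow> 'u::ab_group_add) \<Rightarrow> 'u nspace \<Rightarrow> ('u \<Rightarrow> 'u) \<Rightarrow>
      nat \<Rightarrow> (nat \<Rightarrow> 'u \<Rightarrow> complex) \<Rightarrow> (nat \<Rightarrow> 'u) \<Rightarrow> bool" where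
  "finite_rank_rep s X u N \<phi> a \<longleftrightarrow>
     (\<forall>k<N. \<phi> k \<in> dual s X \<and> a k \<in> pts X) \<and> u = (\<lambda>x. \<Sum>k<N. s (\<phi> k x) (a k))"

definition finite_rank_ops ::
    "(complex \<Rightarrow> 'u \<Rightarrow> 'u::ab_group_add) \<Rightarrow> 'u nspace \<Rightarrow> ('u \<Rightarrow> 'u) set" where
  "finite_rank_ops s X = {u. \<exists>N \<phi> a. finite_rank_rep s X u N \<phi> a}"

definition op_trace ::
    "(complex \<Rightarrow> 'u \<Rightarrow> 'u::ab_group_add) \<Rightarrow> 'u nspace \<Rightarrow> ('u \<Rightarrow> 'u) \<Rightarrow> complex" where
  "op_trace s X u =
     (THE t. \<exists>N \<phi> a. finite_rank_rep s X u N \<phi> a \<and> t = (\<Sum>k<N. \<phi> k (a k)))"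

definition eigenvalues ::
    "(complex \<Rightarrow> 'u \<Rightarrow> 'u::ab_group_add) \<Rightarrow> 'u nspace \<Rightarrow> ('u \<Rightarrow> 'u) \<Rightarrow> complex set" where
  "eigenvalues s X u = {\<mu>. \<exists>x\<in>pts X. x \<noteq> 0 \<and> u x = s \<mu> x}"

definition alg_multiplicity ::
    "(complex \<Rightarrow> 'u \<Rightarrow> 'u::ab_group_add) \<Rightarrow> 'u nspace \<Rightarrow> ('u \<Rightarrow> 'u) \<Rightarrow> complex \<Rightarrow> nat" where
  "alg_multiplicity s X u \<mu> =
     vector_space.dim s {x\<in>pts X. \<exists>n. ((\<lambda>y. u y - s \<mu> y) ^^ n) x = 0}"

text \<open>
  The eigenvalue 0 is left out: it would contribute the factor 1, and its multiplicity is infinite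
  when \<open>X\<close> is infinite-dimensional.
\<close>

definition det_one_minus ::
    "(complex \<Rightarrow> 'u \<Rightarrow> 'u::ab_group_add) \<Rightarrow> 'u nspace \<Rightarrow> ('u \<Rightarrow> 'u) \<Rightarrow> complex" where
  "det_one_minus s X u = (\<Prod>\<mu>\<in>eigenvalues s X u - {0}. (1 - \<mu>) ^ alg_multiplicity s X u \<mu>)"

end

theory Submission
  imports Defs "HOL-Analysis.Complex_Transcendental" "Jordan_Normal_Form.Schur_Decomposition"
begin

text \<open>
  Write \<open>Det u\<close> for the determinant of \<open>1 - u\<close>. It suffices that \<open>Det\<close> satisfies the Cauchy
  condition at each \<open>u\<close> of the ideal (\<open>det_cauchy\<close>): if \<open>v\<close> and \<open>w\<close> have finite rank and are close to
  \<open>u\<close>, then \<open>Det v\<close> and \<open>Det w\<close> are close. Four facts give this.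

  \<^item> \<open>Det (g + w - g w) = Det g * Det w\<close> for finite rank \<open>g\<close> and \<open>w\<close> (\<open>det_one_minus_mult\<close>). Both
    operators can be written with the same vectors, and then this is the product rule for matrices,
    since \<open>Det (\<Sum> \<phi>\<^sub>k \<otimes> a\<^sub>k)\<close> is the determinant of the matrix \<open>1 - (\<phi>\<^sub>i (a\<^sub>j))\<close>.
    The latter (\<open>det_one_minus_eq_det\<close>) is seen by bringing the matrix into triangular form, where
    the algebraic multiplicities can be read off from the diagonal (\<open>gen_eigenspace_triangular\<close>).

  \<^item> The quasinorm dominates the operator norm (\<open>norm_le_quasinorm\<close>). This uses the Hahn-Banach
    theorem, in the form of \<open>ex_norming_functional\<close>.

  \<^item> \<open>Det w\<close> tends to 1 as the quasinorm of \<open>w\<close> tends to 0 (\<open>det_continuous_at_zero\<close>). If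
    the quasinorm of \<open>w\<close> is at most \<open>1/2\<close>, then so is the modulus of each eigenvalue \<open>\<mu>\<^sub>i\<close> of \<open>w\<close>,
    \<open>ln (1 - \<mu>\<^sub>i)\<close> expands into a power series, and \<open>Det w = exp (- \<Sum> trace (w^k) / k)\<close>. The bound
    on the trace and the ideal property make the terms decay geometrically, with a factor
    proportional to the quasinorm of \<open>w\<close>.

  \<^item> For fixed \<open>v0\<close> of finite rank, \<open>Det ((1 - g)\<inverse> v0)\<close> is Lipschitz in \<open>g\<close> of quasinorm at most \<open>1/2\<close>
    (\<open>det_resolvent_lipschitz\<close>), being the determinant of a matrix of fixed size whose entries
    depend on \<open>g\<close> in this way.

  Now choose \<open>v0\<close> of finite rank near \<open>u\<close>. For \<open>v\<close> near \<open>u\<close> the difference \<open>h = v - v0\<close> is small, and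
  \<open>1 - v = (1 - h) (1 - (1 - h)\<inverse> v0)\<close> gives \<open>Det v = Det h * Det ((1 - h)\<inverse> v0)\<close>. The second factor
  is covered by the last fact. For the first factor, the same factorisation gives
  \<open>Det h = Det g * Det ((1 - g)\<inverse> (h - g))\<close>, where the last factor is close to 1 when \<open>h - g\<close> is small.
\<close>

section \<open>Banach spaces inside the universe\<close>

text \<open>A fixed Banach space of the universe, in which all operators and functionals live.\<close>

locale banach_in_universe = vector_space s
  for s :: "complex \<Rightarrow> 'u \<Rightarrow> 'u::ab_group_add" +
  fixes X :: "'u nspace"
  assumes banach: "banach_space s X"
begin

lemma pts_subspace: "subspace (pts X)"
  using banach by (simp add: banach_space_def)

lemmas pts_zero [simp] = subspace_0[OF pts_subspace]
lemmas pts_add [simp] = subspace_add[OF pts_subspace]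
lemmas pts_diff [simp] = subspace_diff[OF pts_subspace]
lemmas pts_neg [simp] = subspace_neg[OF pts_subspace]
lemmas pts_scale [simp] = subspace_scale[OF pts_subspace]
lemmas pts_sum = subspace_sum[OF pts_subspace]

lemma nrm_nonneg [simp]: "x \<in> pts X \<Longrightarrow> 0 \<le> nrm X x"
  using banach by (simp add: banach_space_def)

lemma nrm_eq_0_iff [simp]: "x \<in> pts X \<Longrightarrow> nrm X x = 0 \<longleftrightarrow> x = 0"
  using banach by (simp add: banach_space_def)

lemma nrm_scale: "x \<in> pts X \<Longrightarrow> nrm X (s c x) = cmod c * nrm X x"
  using banach by (simp add: banach_space_def)

lemma nrm_triangle: "x \<in> pts X \<Longrightarrow> y \<in> pts X \<Longrightarrow> nrm X (x + y) \<le> nrm X x + nrm X y"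
  using banach by (simp add: banach_space_def)

lemma nrm_zero [simp]: "nrm X 0 = 0"
  by simp

lemma nrm_minus: "x \<in> pts X \<Longrightarrow> nrm X (- x) = nrm X x"
  using nrm_scale[of x "-1"] by simp

lemma nrm_diff_commute: "x \<in> pts X \<Longrightarrow> y \<in> pts X \<Longrightarrow> nrm X (x - y) = nrm X (y - x)"
  using nrm_minus[of "x - y"] by simp

lemma nrm_pos: "x \<in> pts X \<Longrightarrow> x \<noteq> 0 \<Longrightarrow> 0 < nrm X x"
  using nrm_nonneg[of x] nrm_eq_0_iff[of x] by linarith

lemma nrm_complete:
  assumes "\<And>n. f n \<in> pts X"
    and "\<And>e. e > 0 \<Longrightarrow> \<exists>M. \<forall>m\<ge>M. \<forall>n\<ge>M. nrm X (f m - f n) < e"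
  obtains l where "l \<in> pts X" "(\<lambda>n. nrm X (f n - l)) \<longlonglongrightarrow> 0"
proof -
  have "(\<forall>n. f n \<in> pts X) \<and> (\<forall>e>0. \<exists>M. \<forall>m\<ge>M. \<forall>n\<ge>M. nrm X (f m - f n) < e) \<longrightarrow>
        (\<exists>l\<in>pts X. (\<lambda>n. nrm X (f n - l)) \<longlonglongrightarrow> 0)"
    using banach unfolding banach_space_def by (elim conjE) (erule spec)
  then show ?thesis using assms that by blast
qed

section \<open>Norming functionals\<close>

text \<open>
  Real sublinear functionals on the space, normalised to vanish outside it so that they are
  ordered pointwise on the whole universe. For positive homogeneity an inequality suffices,
  because it can be applied to the inverse factor as well.
\<close>

definition sublinear :: "('u \<Rightarrow> real) \<Rightarrow> bool" where
  "sublinear f \<longleftrightarrow> f 0 = 0 \<and> (\<forall>x. x \<notin> pts X \<longrightarrow> f x = 0) \<and>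
     (\<forall>x\<in>pts X. \<forall>y\<in>pts X. f (x + y) \<le> f x + f y) \<and>
     (\<forall>t>0. \<forall>x\<in>pts X. f (s (of_real t) x) \<le> t * f x)"

lemma sublinear_scale:
  assumes f: "sublinear f" and x: "x \<in> pts X" and t: "t \<ge> 0"
  shows "f (s (of_real t) x) = t * f x"
proof (cases "t = 0")
  case True
  then show ?thesis using f by (simp add: sublinear_def)
next
  case False
  then have t: "t > 0" using t by simp
  have fhom: "f (s (of_real c) y) \<le> c * f y" if "c > 0" "y \<in> pts X" for c y
    using f that by (simp add: sublinear_def)
  have "f x = f (s (of_real (1/t)) (s (of_real t) x))"
    using t by (simp flip: of_real_mult)
  also have "\<dots> \<le> (1/t) * f (s (of_real t) x)"
    using fhom[of "1/t" "s (of_real t) x"] t x by (simp del: scale_scale)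
  finally have "t * f x \<le> f (s (of_real t) x)"
    using t by (simp add: field_simps)
  moreover have "f (s (of_real t) x) \<le> t * f x"
    using f t x by (simp add: sublinear_def)
  ultimately show ?thesis by simp
qed

lemma sublinear_lower:
  assumes f: "sublinear f" and x: "x \<in> pts X"
  shows "- f (- x) \<le> f x"
proof -
  have "f (x + - x) \<le> f x + f (- x)"
    using f x unfolding sublinear_def by (meson pts_neg)
  then show ?thesis using f by (simp add: sublinear_def)
qed

text \<open>
  Every sublinear functional can be lowered so as to become odd at a given point. Applied to a
  minimal sublinear functional this shows that it is odd, hence additive; applied to the norm it
  prescribes the value of the functional at one point.
\<close>

lemma sublinear_lowering:
  assumes f: "sublinear f" and y: "y \<in> pts X"
  shows "\<exists>g. sublinear g \<and> (\<forall>x. g x \<le> f x) \<and> g (- y) \<le> - f y"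
proof -
  define F where "F x t = f (x + s (of_real t) y) - t * f y" for x t
  define g where "g x = (if x \<in> pts X then (INF t\<in>{0..}. F x t) else 0)" for x
  have f0: "f 0 = 0" and fadd: "\<And>x y. x \<in> pts X \<Longrightarrow> y \<in> pts X \<Longrightarrow> f (x + y) \<le> f x + f y"
    using f by (auto simp: sublinear_def)
  have low: "- f (- x) \<le> F x t" if "x \<in> pts X" "t \<ge> 0" for x t
  proof -
    have "f (x + s (of_real t) y + - x) \<le> f (x + s (of_real t) y) + f (- x)"
      using that y by (intro fadd) auto
    then show ?thesis
      using sublinear_scale[OF f y] that by (simp add: F_def)
  qed
  have bdd: "bdd_below (F x ` {0..})" if "x \<in> pts X" for x
    using low[OF that] by (intro bdd_belowI[of _ "- f (- x)"]) auto
  have gle: "g x \<le> F x t" if "x \<in> pts X" "t \<ge> 0" for x t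
    using that bdd[of x] by (simp add: g_def cINF_lower)
  have gge: "c \<le> g x" if "x \<in> pts X" "\<And>t. t \<ge> 0 \<Longrightarrow> c \<le> F x t" for x c
    using that by (auto simp: g_def intro!: cINF_greatest)
  have F0: "F 0 t = 0" if "t \<ge> 0" for t
    using that sublinear_scale[OF f y] by (simp add: F_def)
  have g0: "g 0 = 0"
    using gle[of 0 0] gge[of 0 0] F0 by fastforce
  have gadd: "g (x + x') \<le> g x + g x'" if x: "x \<in> pts X" "x' \<in> pts X" for x x'
  proof -
    have *: "g (x + x') \<le> F x t + F x' t'" if t: "t \<ge> 0" "t' \<ge> 0" for t t'
    proof -
      have "f ((x + s (of_real t) y) + (x' + s (of_real t') y))
          \<le> f (x + s (of_real t) y) + f (x' + s (of_real t') y)"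
        using x y by (intro fadd) auto
      then have "F (x + x') (t + t') \<le> F x t + F x' t'"
        by (simp add: F_def scale_left_distrib algebra_simps)
      then show ?thesis using gle[of "x + x'" "t + t'"] x t by simp
    qed
    have "g (x + x') - g x' \<le> F x t" if t: "t \<ge> 0" for t
      using gge[OF x(2), of "g (x + x') - F x t"] *[OF t] by (force simp: algebra_simps)
    then show ?thesis using gge[OF x(1), of "g (x + x') - g x'"] by force
  qed
  have gscale: "g (s (of_real c) x) \<le> c * g x" if x: "x \<in> pts X" and c: "c > 0" for c x
  proof -
    have "g (s (of_real c) x) / c \<le> F x t" if t: "t \<ge> 0" for t
    proof -
      have "g (s (of_real c) x) \<le> F (s (of_real c) x) (c * t)"
        using x c t by (intro gle) auto
      also have "\<dots> = f (s (of_real c) (x + s (of_real t) y)) - c * t * f y"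
        by (simp add: F_def scale_right_distrib)
      also have "\<dots> = c * F x t"
        using sublinear_scale[OF f, of "x + s (of_real t) y" c] x y c
        by (simp add: F_def algebra_simps)
      finally show ?thesis using c by (simp add: field_simps)
    qed
    then have "g (s (of_real c) x) / c \<le> g x" using gge[OF x] by blast
    then show ?thesis using c by (simp add: field_simps)
  qed
  have "sublinear g"
    unfolding sublinear_def using g0 gadd gscale by (auto simp: g_def)
  moreover have "g x \<le> f x" for x
    using gle[of x 0] f by (cases "x \<in> pts X") (auto simp: F_def g_def sublinear_def)
  moreover have "g (- y) \<le> - f y"
    using gle[of "- y" 1] y f0 by (simp add: F_def)
  ultimately show ?thesis by blast
qed

lemma ex_minimal_sublinear:
  assumes f: "sublinear f"
  shows "\<exists>m. sublinear m \<and> (\<forall>x. m x \<le> f x) \<and> (\<forall>g. sublinear g \<longrightarrow> (\<forall>x. g x \<le> m x) \<longrightarrow> g = m)"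
proof -
  define B where "B = {g. sublinear g \<and> g \<le> f}"
  define P where "P = (\<lambda>g h :: 'u \<Rightarrow> real. h \<le> g)"
  have po: "partial_order_on B (relation_of P B)"
    by (auto simp: partial_order_on_def preorder_on_def refl_on_def trans_def antisym_def
        relation_of_def P_def)
  have "\<exists>m\<in>B. \<forall>a\<in>B. P m a \<longrightarrow> a = m"
  proof (rule predicate_Zorn[OF po])
    fix C assume C: "C \<in> Chains (relation_of P B)"
    have CB: "g \<in> B" if "g \<in> C" for g
      using C that by (auto simp: Chains_def relation_of_def)
    have tot: "g \<le> h \<or> h \<le> g" if "g \<in> C" "h \<in> C" for g h
      using C that by (auto simp: Chains_def relation_of_def P_def)
    show "\<exists>u\<in>B. \<forall>a\<in>C. P a u"
    proof (cases "C = {}")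
      case True
      then show ?thesis using f by (auto simp: B_def)
    next
      case False
      define u where "u x = (INF g\<in>C. g x)" for x
      have low: "- f (- x) \<le> g x" if "g \<in> C" "x \<in> pts X" for g x
      proof -
        have "sublinear g" "g (- x) \<le> f (- x)"
          using CB[OF that(1)] by (auto simp: B_def le_fun_def)
        then show ?thesis using sublinear_lower[of g x] that by simp
      qed
      have out: "g x = 0" if "g \<in> C" "x \<notin> pts X" for g x
        using CB[OF that(1)] that by (auto simp: B_def sublinear_def)
      have bdd: "bdd_below ((\<lambda>g. g x) ` C)" for x
      proof (cases "x \<in> pts X")
        case True
        then show ?thesis using low by (intro bdd_belowI[of _ "- f (- x)"]) auto
      next
        case False
        then show ?thesis by (intro bdd_belowI[of _ 0]) (metis imageE order_refl out)
      qed
      have ule: "u x \<le> g x" if "g \<in> C" for g x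
        unfolding u_def using cINF_lower[OF bdd that] by simp
      have uge: "c \<le> u x" if "\<And>g. g \<in> C \<Longrightarrow> c \<le> g x" for x c
        unfolding u_def using that False by (intro cINF_greatest) auto
      obtain g0 where g0: "g0 \<in> C" using False by auto
      have u0: "u x = 0" if "x \<notin> pts X \<or> x = 0" for x
      proof -
        have "g x = 0" if "g \<in> C" for g
          using CB[OF that] \<open>x \<notin> pts X \<or> x = 0\<close> by (auto simp: B_def sublinear_def)
        then show ?thesis using ule[OF g0, of x] uge[of 0 x] g0 by force
      qed
      have uadd: "u (x + y) \<le> u x + u y" if x: "x \<in> pts X" "y \<in> pts X" for x y
      proof -
        have *: "u (x + y) \<le> g x + h y" if gh: "g \<in> C" "h \<in> C" for g h
        proof -
          obtain k where k: "k \<in> C" "k \<le> g" "k \<le> h" using tot[OF gh] gh by blast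
          have "u (x + y) \<le> k (x + y)" using ule k by blast
          also have "\<dots> \<le> k x + k y" using CB[OF k(1)] x by (auto simp: B_def sublinear_def)
          also have "\<dots> \<le> g x + h y" using k by (auto simp: le_fun_def intro: add_mono)
          finally show ?thesis .
        qed
        have "u (x + y) - u y \<le> g x" if g: "g \<in> C" for g
          using uge[of "u (x + y) - g x" y] *[OF g] by (force simp: algebra_simps)
        then show ?thesis using uge[of "u (x + y) - u y" x] by force
      qed
      have uscale: "u (s (of_real t) x) \<le> t * u x" if x: "x \<in> pts X" and t: "t > 0" for x t
      proof -
        have "u (s (of_real t) x) / t \<le> g x" if g: "g \<in> C" for g
        proof -
          have "g (s (of_real t) x) \<le> t * g x"
            using CB[OF g] x t by (auto simp: B_def sublinear_def)
          then show ?thesis using ule[OF g, of "s (of_real t) x"] t by (simp add: field_simps)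
        qed
        then have "u (s (of_real t) x) / t \<le> u x" using uge by blast
        then show ?thesis using t by (simp add: field_simps)
      qed
      have "sublinear u" unfolding sublinear_def using u0 uadd uscale by auto
      moreover have "u \<le> f"
        using ule[OF g0] CB[OF g0] by (auto simp: B_def le_fun_def intro: order_trans)
      ultimately have "u \<in> B" by (simp add: B_def)
      then show ?thesis using ule by (auto simp: P_def le_fun_def)
    qed
  qed
  then obtain m where m: "m \<in> B" "\<And>a. a \<in> B \<Longrightarrow> P m a \<Longrightarrow> a = m" by blast
  have "g = m" if "sublinear g" "\<forall>x. g x \<le> m x" for g
    using m that by (auto simp: B_def P_def le_fun_def intro: order_trans)
  then show ?thesis using m(1) by (auto simp: B_def le_fun_def)
qed

text \<open>
  The Hahn-Banach theorem for one prescribed value: lower the norm at \<open>x0\<close>, pass to a minimal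
  sublinear functional, which is real linear, and take the complex functional with this real part.
\<close>

lemma ex_norming_functional:
  assumes x0: "x0 \<in> pts X"
  obtains \<phi> where "\<phi> \<in> dual s X" "\<And>x. x \<in> pts X \<Longrightarrow> cmod (\<phi> x) \<le> nrm X x"
    "nrm X x0 \<le> cmod (\<phi> x0)"
proof -
  define p where "p x = (if x \<in> pts X then nrm X x else 0)" for x
  have "sublinear p"
    by (auto simp: sublinear_def p_def nrm_triangle nrm_scale)
  from sublinear_lowering[OF this x0] obtain g where
    g: "sublinear g" "\<And>x. g x \<le> p x" "g (- x0) \<le> - p x0" by blast
  from ex_minimal_sublinear[OF g(1)] obtain m where
    m: "sublinear m" "\<And>x. m x \<le> g x" "\<And>h. sublinear h \<Longrightarrow> \<forall>x. h x \<le> m x \<Longrightarrow> h = m" by blast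
  have odd: "m (- y) = - m y" if y: "y \<in> pts X" for y
  proof -
    obtain h where h: "sublinear h" "\<forall>x. h x \<le> m x" "h (- y) \<le> - m y"
      using sublinear_lowering[OF m(1) y] by blast
    then have "h = m" using m(3) by blast
    then show ?thesis using h(3) sublinear_lower[OF m(1), of "- y"] y by simp
  qed
  have madd_le: "m (x + y) \<le> m x + m y" if "x \<in> pts X" "y \<in> pts X" for x y
    using m(1) that by (simp add: sublinear_def)
  have madd: "m (x + y) = m x + m y" if "x \<in> pts X" "y \<in> pts X" for x y
    using madd_le[OF that] madd_le[of "- x" "- y"] odd[of x] odd[of y] odd[of "x + y"] that
    by (simp add: algebra_simps)
  have mscale: "m (s (of_real t) x) = t * m x" if x: "x \<in> pts X" for t x
  proof (cases "t \<ge> 0")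
    case False
    then have "m (s (of_real (- t)) x) = - t * m x"
      using sublinear_scale[OF m(1) x, of "- t"] by simp
    then show ?thesis using odd[of "s (of_real t) x"] x by simp
  qed (simp add: sublinear_scale[OF m(1) x])
  have mle: "m x \<le> nrm X x" if "x \<in> pts X" for x
    using m(2)[of x] g(2)[of x] that by (simp add: p_def)
  have mx0: "nrm X x0 \<le> m x0"
    using m(2)[of "- x0"] g(3) odd[OF x0] x0 by (simp add: p_def)
  define \<phi> where "\<phi> x = Complex (m x) (- m (s \<i> x))" for x
  have add: "\<phi> (x + y) = \<phi> x + \<phi> y" if "x \<in> pts X" "y \<in> pts X" for x y
    using that by (simp add: \<phi>_def complex_eq_iff madd scale_right_distrib)
  have sc: "\<phi> (s c x) = c * \<phi> x" if x: "x \<in> pts X" for c x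
  proof -
    have 1: "m (s c x) = Re c * m x + Im c * m (s \<i> x)" for c
    proof -
      have "s c x = s (of_real (Re c)) x + s (of_real (Im c)) (s \<i> x)"
        by (simp add: complex_eq[of c, symmetric] mult.commute flip: scale_left_distrib)
      then show ?thesis using x by (simp only: madd pts_scale mscale)
    qed
    have 2: "m (s \<i> (s c x)) = - Im c * m x + Re c * m (s \<i> x)"
      using 1[of "\<i> * c"] by simp
    show ?thesis
      by (simp add: \<phi>_def complex_eq_iff 1[of c] 2 algebra_simps del: scale_scale)
  qed
  have bd: "cmod (\<phi> x) \<le> nrm X x" if x: "x \<in> pts X" for x
  proof -
    \<comment> \<open>Rotate \<open>x\<close> so that the value of the functional becomes its real part.\<close>
    define c where "c = (if \<phi> x = 0 then 0 else cnj (\<phi> x) / cmod (\<phi> x))"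
    have c: "cmod c \<le> 1" by (simp add: c_def norm_divide)
    have "c * \<phi> x = of_real (cmod (\<phi> x))"
      by (simp add: c_def complex_norm_square[symmetric] mult.commute power2_eq_square)
    then have "cmod (\<phi> x) = Re (\<phi> (s c x))" using sc[OF x] by simp
    also have "\<dots> = m (s c x)" by (simp add: \<phi>_def)
    also have "\<dots> \<le> cmod c * nrm X x" using mle[of "s c x"] x by (simp add: nrm_scale)
    also have "\<dots> \<le> nrm X x" using c x by (simp add: mult_left_le_one_le)
    finally show ?thesis .
  qed
  have "s \<i> x \<in> pts X \<longleftrightarrow> x \<in> pts X" for x
  proof
    assume "s \<i> x \<in> pts X"
    then have "s (- \<i>) (s \<i> x) \<in> pts X" by (rule pts_scale)
    then show "x \<in> pts X" by simp
  qed simp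
  then have out: "\<phi> x = 0" if "x \<notin> pts X" for x
    using m(1) that by (simp add: \<phi>_def sublinear_def complex_eq_iff)
  have "\<phi> \<in> dual s X"
    unfolding dual_def using out add sc bd by (auto intro!: exI[of _ 1])
  moreover have "nrm X x0 \<le> cmod (\<phi> x0)"
    using mx0 complex_Re_le_cmod[of "\<phi> x0"] by (simp add: \<phi>_def)
  ultimately show ?thesis using bd that by blast
qed

section \<open>Linear maps and finite rank operators\<close>

text \<open>Linear maps of the space into itself. Nothing is required outside the space.\<close>

definition linear_on_pts :: "('u \<Rightarrow> 'u) \<Rightarrow> bool" where
  "linear_on_pts f \<longleftrightarrow> (\<forall>x\<in>pts X. f x \<in> pts X) \<and>
     (\<forall>x\<in>pts X. \<forall>y\<in>pts X. f (x + y) = f x + f y) \<and> (\<forall>c. \<forall>x\<in>pts X. f (s c x) = s c (f x))"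

lemma linear_on_pts_mem: "linear_on_pts f \<Longrightarrow> x \<in> pts X \<Longrightarrow> f x \<in> pts X"
  and linear_on_pts_add: "linear_on_pts f \<Longrightarrow> x \<in> pts X \<Longrightarrow> y \<in> pts X \<Longrightarrow> f (x + y) = f x + f y"
  and linear_on_pts_scale: "linear_on_pts f \<Longrightarrow> x \<in> pts X \<Longrightarrow> f (s c x) = s c (f x)"
  by (auto simp: linear_on_pts_def)

lemma linear_on_pts_zero: "linear_on_pts f \<Longrightarrow> f 0 = 0"
  using linear_on_pts_scale[of f 0 0] by simp

lemma linear_on_pts_diff:
  assumes f: "linear_on_pts f" and x: "x \<in> pts X" and y: "y \<in> pts X"
  shows "f (x - y) = f x - f y"
  using linear_on_pts_add[OF f, of "x - y" y] x y by simp

lemma linear_on_pts_sum: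
  assumes f: "linear_on_pts f" and x: "\<And>i. i \<in> I \<Longrightarrow> x i \<in> pts X"
  shows "f (\<Sum>i\<in>I. x i) = (\<Sum>i\<in>I. f (x i))"
  using x
proof (induction I rule: infinite_finite_induct)
  case (insert i I)
  then show ?case using linear_on_pts_add[OF f, of "x i" "sum x I"] by (simp add: pts_sum)
qed (simp_all add: linear_on_pts_zero[OF f])

lemma linear_on_pts_funpow: "linear_on_pts f \<Longrightarrow> linear_on_pts (f ^^ n)"
  by (induction n) (auto simp: linear_on_pts_def)

lemma dual_add: "\<phi> \<in> dual s X \<Longrightarrow> x \<in> pts X \<Longrightarrow> y \<in> pts X \<Longrightarrow> \<phi> (x + y) = \<phi> x + \<phi> y"
  and dual_scale: "\<phi> \<in> dual s X \<Longrightarrow> x \<in> pts X \<Longrightarrow> \<phi> (s c x) = c * \<phi> x"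
  and dual_outside: "\<phi> \<in> dual s X \<Longrightarrow> x \<notin> pts X \<Longrightarrow> \<phi> x = 0"
  by (auto simp: dual_def)

lemma dual_apply_zero: "\<phi> \<in> dual s X \<Longrightarrow> \<phi> 0 = 0"
  using dual_scale[of \<phi> 0 0] by simp

lemma dual_apply_diff:
  "\<phi> \<in> dual s X \<Longrightarrow> x \<in> pts X \<Longrightarrow> y \<in> pts X \<Longrightarrow> \<phi> (x - y) = \<phi> x - \<phi> y"
  using dual_add[of \<phi> "x - y" y] by simp

lemma dual_apply_sum:
  assumes f: "\<phi> \<in> dual s X" and x: "\<And>i. i \<in> I \<Longrightarrow> x i \<in> pts X"
  shows "\<phi> (\<Sum>i\<in>I. x i) = (\<Sum>i\<in>I. \<phi> (x i))"
  using x
proof (induction I rule: infinite_finite_induct)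
  case (insert i I)
  then show ?case using dual_add[OF f, of "x i" "sum x I"] by (simp add: pts_sum)
qed (simp_all add: dual_apply_zero[OF f])

lemma dual_bound:
  assumes "\<phi> \<in> dual s X"
  obtains B where "B \<ge> 0" "\<And>x. x \<in> pts X \<Longrightarrow> cmod (\<phi> x) \<le> B * nrm X x"
proof -
  obtain B where B: "\<And>x. x \<in> pts X \<Longrightarrow> cmod (\<phi> x) \<le> B * nrm X x"
    using assms unfolding dual_def by blast
  have "cmod (\<phi> x) \<le> \<bar>B\<bar> * nrm X x" if "x \<in> pts X" for x
    using B[OF that] that by (meson abs_ge_self dual_order.trans mult_right_mono nrm_nonneg)
  then show ?thesis using that[of "\<bar>B\<bar>"] by simp
qed

lemma dual_sum:
  assumes "\<And>i. i \<in> I \<Longrightarrow> \<phi> i \<in> dual s X"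
  shows "(\<lambda>x. \<Sum>i\<in>I. c i * \<phi> i x) \<in> dual s X"
proof -
  have "\<exists>B. \<forall>x\<in>pts X. cmod (\<phi> i x) \<le> B * nrm X x" if "i \<in> I" for i
    using assms[OF that] by (auto simp: dual_def)
  then obtain B where B: "\<And>i x. i \<in> I \<Longrightarrow> x \<in> pts X \<Longrightarrow> cmod (\<phi> i x) \<le> B i * nrm X x"
    by metis
  have "cmod (\<Sum>i\<in>I. c i * \<phi> i x) \<le> (\<Sum>i\<in>I. cmod (c i) * B i) * nrm X x" if x: "x \<in> pts X" for x
  proof -
    have "cmod (\<Sum>i\<in>I. c i * \<phi> i x) \<le> (\<Sum>i\<in>I. cmod (c i) * (B i * nrm X x))"
      using B x by (intro sum_norm_le) (simp add: norm_mult mult_left_mono)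
    then show ?thesis by (simp add: sum_distrib_right mult.assoc)
  qed
  then have "\<exists>B. \<forall>x\<in>pts X. cmod (\<Sum>i\<in>I. c i * \<phi> i x) \<le> B * nrm X x" by blast
  then show ?thesis
    unfolding dual_def using assms
    by (auto simp: dual_add dual_scale dual_outside algebra_simps sum.distrib sum_distrib_left)
qed

text \<open>The operator given by functionals \<open>\<phi> k\<close> and vectors \<open>a k\<close> with \<open>k < N\<close>.\<close>

definition rank_sum :: "nat \<Rightarrow> (nat \<Rightarrow> 'u \<Rightarrow> complex) \<Rightarrow> (nat \<Rightarrow> 'u) \<Rightarrow> 'u \<Rightarrow> 'u" where
  "rank_sum N \<phi> a = (\<lambda>x. \<Sum>k<N. s (\<phi> k x) (a k))"

text \<open>Admissible data for \<open>rank_sum\<close>; entries with index from \<open>N\<close> on are arbitrary.\<close>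

definition system :: "nat \<Rightarrow> (nat \<Rightarrow> 'u \<Rightarrow> complex) \<Rightarrow> (nat \<Rightarrow> 'u) \<Rightarrow> bool" where
  "system N \<phi> a \<longleftrightarrow> (\<forall>k<N. \<phi> k \<in> dual s X \<and> a k \<in> pts X)"

lemma finite_rank_rep_iff: "finite_rank_rep s X u N \<phi> a \<longleftrightarrow> system N \<phi> a \<and> u = rank_sum N \<phi> a"
  by (simp add: finite_rank_rep_def system_def rank_sum_def)

lemma systemD: "system N \<phi> a \<Longrightarrow> k < N \<Longrightarrow> \<phi> k \<in> dual s X"
    "system N \<phi> a \<Longrightarrow> k < N \<Longrightarrow> a k \<in> pts X"
  by (auto simp: system_def)

lemma linear_rank_sum: "system N \<phi> a \<Longrightarrow> linear_on_pts (rank_sum N \<phi> a)"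
  unfolding linear_on_pts_def rank_sum_def system_def
  by (auto intro!: pts_sum simp: dual_add dual_scale scale_left_distrib sum.distrib scale_sum_right)

lemma dual_rank_sum:
  assumes "system N \<phi> a" "\<psi> \<in> dual s X"
  shows "\<psi> (rank_sum N \<phi> a x) = (\<Sum>k<N. \<phi> k x * \<psi> (a k))"
proof -
  have "\<psi> (rank_sum N \<phi> a x) = (\<Sum>k<N. \<psi> (s (\<phi> k x) (a k)))"
    unfolding rank_sum_def using assms(1) by (intro dual_apply_sum assms(2)) (simp add: systemD)
  then show ?thesis
    using assms by (simp add: systemD dual_scale)
qed

section \<open>Eigenvalues of an operator in triangular form\<close>

text \<open>The generalised eigenspace, whose dimension is the algebraic multiplicity.\<close>

definition gen_eigenspace :: "('u \<Rightarrow> 'u) \<Rightarrow> complex \<Rightarrow> 'u set" where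
  "gen_eigenspace u \<mu> = {x\<in>pts X. \<exists>n. ((\<lambda>y. u y - s \<mu> y) ^^ n) x = 0}"

lemma linear_shift:
  assumes "linear_on_pts u"
  shows "linear_on_pts (\<lambda>y. u y - s \<mu> y)"
  using assms by (auto simp: linear_on_pts_def algebra_simps scale_right_distrib scale_right_diff_distrib)

lemma funpow_zero_mono:
  fixes f :: "'u \<Rightarrow> 'u"
  assumes "f 0 = 0" "(f ^^ n) x = 0" "n \<le> m"
  shows "(f ^^ m) x = 0"
proof -
  have "(f ^^ k) 0 = 0" for k using assms(1) by (induction k) auto
  then show ?thesis
    using assms(2,3) funpow_add[of "m - n" n f] by simp
qed

lemma gen_eigenspace_subspace:
  assumes u: "linear_on_pts u"
  shows "subspace (gen_eigenspace u \<mu>)"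
proof -
  define f where "f = (\<lambda>y. u y - s \<mu> y)"
  have f: "linear_on_pts f" unfolding f_def by (rule linear_shift[OF u])
  note fn = linear_on_pts_funpow[OF f]
  have add: "\<exists>n. (f ^^ n) (x + y) = 0"
    if x: "x \<in> pts X" "(f ^^ n) x = 0" and y: "y \<in> pts X" "(f ^^ m) y = 0" for x y n m
  proof -
    have "(f ^^ max n m) x = 0" "(f ^^ max n m) y = 0"
      using funpow_zero_mono[where f = f, OF linear_on_pts_zero[OF f]] x y by (meson max.cobounded1 max.cobounded2)+
    then have "(f ^^ max n m) (x + y) = 0"
      using linear_on_pts_add[OF fn x(1) y(1)] by simp
    then show ?thesis ..
  qed
  have scale: "\<exists>n. (f ^^ n) (s c x) = 0" if "x \<in> pts X" "(f ^^ n) x = 0" for c x n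
    using linear_on_pts_scale[OF fn, of x n c] that by (intro exI[of _ n]) simp
  have zero: "\<exists>n. (f ^^ n) 0 = 0" by (intro exI[of _ 0]) simp
  show ?thesis
    unfolding gen_eigenspace_def f_def[symmetric] by (rule subspaceI) (auto intro: add scale zero)
qed

text \<open>Systems for which the matrix of all \<open>\<phi> i (a j)\<close> is upper triangular.\<close>

definition triangular :: "nat \<Rightarrow> (nat \<Rightarrow> 'u \<Rightarrow> complex) \<Rightarrow> (nat \<Rightarrow> 'u) \<Rightarrow> bool" where
  "triangular N \<phi> a \<longleftrightarrow> system N \<phi> a \<and> (\<forall>i<N. \<forall>j<i. \<phi> i (a j) = 0)"

text \<open>
  The last functional \<open>\<phi>\<close> of a triangular system vanishes on all vectors but the last one. Hence
  the operator agrees on the kernel of \<open>\<phi>\<close> with the operator \<open>u'\<close> given by the shorter system, and it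
  multiplies \<open>\<phi>\<close> by the last diagonal entry \<open>d\<close>. So passing from \<open>u'\<close> to \<open>u\<close> leaves the generalised
  eigenspaces for nonzero \<open>\<mu>\<close> unchanged, except that the one belonging to \<open>d\<close> gains one dimension. To find
  the new vector one needs that modulo the generalised eigenspace every vector is in the range
  of \<open>u - \<mu>\<close>; this is carried along in the induction.
\<close>

lemma gen_eigenspace_triangular:
  assumes "triangular N \<phi> a" and mu: "\<mu> \<noteq> 0"
  shows "(\<exists>B. finite B \<and> card B = card {i. i < N \<and> \<phi> i (a i) = \<mu>} \<and> independent B \<and>
            span B = gen_eigenspace (rank_sum N \<phi> a) \<mu>) \<and>
         (\<forall>x\<in>pts X. \<exists>g\<in>gen_eigenspace (rank_sum N \<phi> a) \<mu>. \<exists>r\<in>pts X.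
            x = g + (rank_sum N \<phi> a r - s \<mu> r))"
  using assms(1)
proof (induction N)
  case 0
  have pow: "((\<lambda>y. rank_sum 0 \<phi> a y - s \<mu> y) ^^ n) x = s ((-\<mu>) ^ n) x" for n x
    by (induction n) (auto simp: rank_sum_def)
  have "gen_eigenspace (rank_sum 0 \<phi> a) \<mu> = {0}"
    using mu unfolding gen_eigenspace_def pow by auto
  moreover have "\<exists>r\<in>pts X. x = 0 + (rank_sum 0 \<phi> a r - s \<mu> r)" if x: "x \<in> pts X" for x
  proof
    show "s (- 1 / \<mu>) x \<in> pts X" using x by (rule pts_scale)
    show "x = 0 + (rank_sum 0 \<phi> a (s (- 1 / \<mu>) x) - s \<mu> (s (- 1 / \<mu>) x))"
      using mu by (simp add: rank_sum_def)
  qed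
  ultimately have "\<forall>x\<in>pts X. \<exists>g\<in>gen_eigenspace (rank_sum 0 \<phi> a) \<mu>. \<exists>r\<in>pts X.
      x = g + (rank_sum 0 \<phi> a r - s \<mu> r)"
    by auto
  moreover have "span {} = gen_eigenspace (rank_sum 0 \<phi> a) \<mu>"
    using \<open>gen_eigenspace (rank_sum 0 \<phi> a) \<mu> = {0}\<close> by simp
  ultimately show ?case
    using independent_empty by (intro conjI exI[of _ "{}"]) simp_all
next
  case (Suc N)
  define \<phi>' where "\<phi>' = \<phi> N"
  define b where "b = a N"
  define d where "d = \<phi>' b"
  define u' where "u' = rank_sum N \<phi> a"
  define u where "u = rank_sum (Suc N) \<phi> a"
  define f' where "f' = (\<lambda>y. u' y - s \<mu> y)"
  define f where "f = (\<lambda>y. u y - s \<mu> y)"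
  define G' where "G' = gen_eigenspace u' \<mu>"
  define G where "G = gen_eigenspace u \<mu>"
  have sys: "system (Suc N) \<phi> a" and tri: "triangular N \<phi> a"
    using Suc.prems by (auto simp: triangular_def system_def)
  have sys': "system N \<phi> a" using tri by (simp add: triangular_def)
  have b: "b \<in> pts X" and phi: "\<phi>' \<in> dual s X"
    using sys by (auto simp: system_def b_def \<phi>'_def)
  have lin': "linear_on_pts u'" and lin: "linear_on_pts u"
    unfolding u'_def u_def by (intro linear_rank_sum sys sys')+
  have flin': "linear_on_pts f'" and flin: "linear_on_pts f"
    unfolding f'_def f_def by (intro linear_shift lin lin')+
  note fn' = linear_on_pts_mem[OF linear_on_pts_funpow[OF flin']]
  note fn = linear_on_pts_mem[OF linear_on_pts_funpow[OF flin]]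
  have u_eq: "u x = u' x + s (\<phi>' x) b" for x
    by (simp add: u_def u'_def rank_sum_def \<phi>'_def b_def)
  have phi_u': "\<phi>' (u' x) = 0" for x
    unfolding u'_def using dual_rank_sum[OF sys' phi] Suc.prems
    by (simp add: triangular_def \<phi>'_def)
  have phi_u: "\<phi>' (u x) = d * \<phi>' x" if "x \<in> pts X" for x
    using that b by (simp add: u_eq dual_add[OF phi] linear_on_pts_mem[OF lin'] dual_scale[OF phi]
        phi_u' d_def)
  have phi_f': "\<phi>' (f' x) = - \<mu> * \<phi>' x" if "x \<in> pts X" for x
    using that by (simp add: f'_def dual_apply_diff[OF phi] linear_on_pts_mem[OF lin'] phi_u'
        dual_scale[OF phi])
  have phi_f: "\<phi>' (f x) = (d - \<mu>) * \<phi>' x" if "x \<in> pts X" for x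
    using that by (simp add: f_def dual_apply_diff[OF phi] linear_on_pts_mem[OF lin] phi_u
        dual_scale[OF phi] algebra_simps)
  have f_eq: "f x = f' x" if "\<phi>' x = 0" for x
    using that by (simp add: f_def f'_def u_eq)
  have phi_fn': "\<phi>' ((f' ^^ n) x) = (- \<mu>) ^ n * \<phi>' x" if "x \<in> pts X" for n x
    using that fn' by (induction n) (auto simp: phi_f')
  have phi_fn: "\<phi>' ((f ^^ n) x) = (d - \<mu>) ^ n * \<phi>' x" if "x \<in> pts X" for n x
    using that fn by (induction n) (auto simp: phi_f)
  have fn_eq: "(f ^^ n) x = (f' ^^ n) x" if "x \<in> pts X" "\<phi>' x = 0" for n x
  proof (induction n)
    case (Suc n)
    have "\<phi>' ((f' ^^ n) x) = 0" using phi_fn' that by simp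
    then show ?case using Suc f_eq by simp
  qed simp
  have G_iff: "x \<in> G \<longleftrightarrow> x \<in> pts X \<and> (\<exists>n. (f ^^ n) x = 0)" for x
    by (simp add: G_def gen_eigenspace_def f_def)
  have G'_iff: "x \<in> G' \<longleftrightarrow> x \<in> pts X \<and> (\<exists>n. (f' ^^ n) x = 0)" for x
    by (simp add: G'_def gen_eigenspace_def f'_def)
  have G'_ker: "\<phi>' x = 0" if x: "x \<in> G'" for x
  proof -
    obtain n where "x \<in> pts X" "(f' ^^ n) x = 0" using x unfolding G'_iff by blast
    then have "(- \<mu>) ^ n * \<phi>' x = 0"
      using phi_fn'[of x n] dual_apply_zero[OF phi] by simp
    then show ?thesis using mu by simp
  qed
  have G_G': "x \<in> G' \<longleftrightarrow> x \<in> G \<and> \<phi>' x = 0" for x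
    using G'_ker fn_eq G_iff G'_iff by metis
  have sub: "subspace G" and sub': "subspace G'"
    unfolding G_def G'_def by (intro gen_eigenspace_subspace lin lin')+
  obtain B where B: "finite B" "card B = card {i. i < N \<and> \<phi> i (a i) = \<mu>}" "independent B" "span B = G'"
    using Suc.IH[OF tri] unfolding G'_def u'_def by blast
  have onto': "\<exists>g\<in>G'. \<exists>r\<in>pts X. x = g + f' r" if "x \<in> pts X" for x
    using Suc.IH[OF tri] that unfolding G'_def u'_def f'_def by blast
  have onto_ker: "\<exists>g\<in>G'. \<exists>r\<in>pts X. \<phi>' r = 0 \<and> x = g + f r" if x: "x \<in> pts X" "\<phi>' x = 0" for x
  proof -
    obtain g r where g: "g \<in> G'" "r \<in> pts X" "x = g + f' r" using onto'[OF x(1)] by blast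
    have "\<phi>' x = \<phi>' g + \<phi>' (f' r)"
      using g G'_iff by (simp add: dual_add[OF phi] linear_on_pts_mem[OF flin'])
    then have "\<phi>' r = 0" using x G'_ker[OF g(1)] phi_f' g(2) mu by simp
    then show ?thesis using g f_eq by metis
  qed
  have "(\<exists>B. finite B \<and> card B = card {i. i < Suc N \<and> \<phi> i (a i) = \<mu>} \<and> independent B \<and> span B = G) \<and>
    (\<forall>x\<in>pts X. \<exists>g\<in>G. \<exists>r\<in>pts X. x = g + f r)"
  proof (cases "d = \<mu>")
    case False
    have "\<phi>' x = 0" if x: "x \<in> G" for x
    proof -
      obtain n where "x \<in> pts X" "(f ^^ n) x = 0" using x unfolding G_iff by blast
      then have "(d - \<mu>) ^ n * \<phi>' x = 0"
        using phi_fn[of x n] dual_apply_zero[OF phi] by simp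
      then show ?thesis using False by simp
    qed
    then have "G = G'" using G_G' by blast
    have eq: "{i. i < Suc N \<and> \<phi> i (a i) = \<mu>} = {i. i < N \<and> \<phi> i (a i) = \<mu>}"
      using False by (auto simp: less_Suc_eq d_def \<phi>'_def b_def)
    have "\<exists>g\<in>G. \<exists>r\<in>pts X. x = g + f r" if x: "x \<in> pts X" for x
    proof -
      define r0 where "r0 = s (1 / (d - \<mu>)) x"
      have r0: "r0 \<in> pts X" using x by (simp add: r0_def)
      have "\<phi>' (f r0) = \<phi>' x"
        using phi_f[OF r0] False x by (simp add: r0_def dual_scale[OF phi])
      then have "\<phi>' (x - f r0) = 0"
        using x r0 by (simp add: dual_apply_diff[OF phi] linear_on_pts_mem[OF flin])
      then obtain g r where "g \<in> G'" "r \<in> pts X" "x - f r0 = g + f r"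
        using onto_ker[of "x - f r0"] x r0 linear_on_pts_mem[OF flin] by auto
      then have "g \<in> G" "r0 + r \<in> pts X" "x = g + f (r0 + r)"
        using r0 \<open>G = G'\<close> by (auto simp: linear_on_pts_add[OF flin] algebra_simps)
      then show ?thesis by blast
    qed
    then show ?thesis using B \<open>G = G'\<close> eq by auto
  next
    case True
    have "f b = u' b"
      using True by (simp add: f_def u_eq d_def)
    moreover obtain g r where g: "g \<in> G'" "r \<in> pts X" "\<phi>' r = 0" "u' b = g + f r"
      using onto_ker[of "u' b"] b phi_u' linear_on_pts_mem[OF lin'] by blast
    ultimately have fw: "f (b - r) = g"
      using b by (simp add: linear_on_pts_diff[OF flin])
    define w where "w = b - r"
    have w: "w \<in> pts X" "\<phi>' w = \<mu>"
      using b g True by (auto simp: w_def dual_apply_diff[OF phi] d_def)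
    have wG: "w \<in> G"
    proof -
      have "g \<in> G" using g(1) G_G' by blast
      then obtain n where "(f ^^ n) (f w) = 0" using fw unfolding G_iff w_def by auto
      then have "(f ^^ Suc n) w = 0" by (simp add: funpow_swap1)
      then show ?thesis using w unfolding G_iff by blast
    qed
    have dec: "x - s (\<phi>' x / \<mu>) w \<in> pts X" "\<phi>' (x - s (\<phi>' x / \<mu>) w) = 0" if "x \<in> pts X" for x
      using that w mu by (auto simp: dual_apply_diff[OF phi] dual_scale[OF phi])
    have "G = span (insert w B)"
    proof
      show "span (insert w B) \<subseteq> G"
        using wG B(4) G_G' by (intro span_minimal sub) (auto intro: span_base)
      show "G \<subseteq> span (insert w B)"
      proof
        fix x assume x: "x \<in> G"
        then have "x - s (\<phi>' x / \<mu>) w \<in> G"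
          using wG sub by (intro subspace_diff subspace_scale)
        then have "x - s (\<phi>' x / \<mu>) w \<in> span B"
          using dec[of x] x G_iff G_G' B(4) by blast
        then show "x \<in> span (insert w B)"
          unfolding span_insert by blast
      qed
    qed
    moreover have "w \<notin> span B" using w mu B(4) G'_ker by auto
    moreover have "w \<notin> B" using calculation(2) span_base by blast
    moreover have "{i. i < Suc N \<and> \<phi> i (a i) = \<mu>} = insert N {i. i < N \<and> \<phi> i (a i) = \<mu>}"
      using True by (auto simp: less_Suc_eq d_def \<phi>'_def b_def)
    ultimately have "finite (insert w B) \<and> card (insert w B) = card {i. i < Suc N \<and> \<phi> i (a i) = \<mu>} \<and>
        independent (insert w B) \<and> span (insert w B) = G"
      using B by (auto simp: independent_insert)
    moreover have "\<exists>g\<in>G. \<exists>r\<in>pts X. x = g + f r" if x: "x \<in> pts X" for x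
    proof -
      obtain g r where g: "g \<in> G'" "r \<in> pts X" "x - s (\<phi>' x / \<mu>) w = g + f r"
        using onto_ker[OF dec[OF x]] by blast
      have "g + s (\<phi>' x / \<mu>) w \<in> G"
        using g(1) G_G' wG sub by (auto intro!: subspace_add subspace_scale)
      moreover have "x = (g + s (\<phi>' x / \<mu>) w) + f r"
        using g(3) by (simp add: algebra_simps)
      ultimately show ?thesis using g(2) by blast
    qed
    ultimately show ?thesis by blast
  qed
  then show ?case unfolding u_def G_def f_def .
qed

end

section \<open>Determinant and trace in terms of a matrix\<close>

lemma mult_mat_index_sum:
  assumes "A \<in> carrier_mat n n" "B \<in> carrier_mat n n" "i < n" "j < n"
  shows "(A * B) $$ (i, j) = (\<Sum>k<n. A $$ (i, k) * B $$ (k, j))"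
  using assms by (auto simp: scalar_prod_def lessThan_atLeast0 intro!: sum.cong)

lemma trace_mult_commute:
  fixes A B :: "'a :: comm_ring_1 mat"
  assumes "A \<in> carrier_mat n n" "B \<in> carrier_mat n n"
  shows "(\<Sum>i<n. (A * B) $$ (i, i)) = (\<Sum>i<n. (B * A) $$ (i, i))"
proof -
  have "(\<Sum>i<n. (A * B) $$ (i, i)) = (\<Sum>i<n. \<Sum>k<n. A $$ (i, k) * B $$ (k, i))"
    using assms by (intro sum.cong refl mult_mat_index_sum) auto
  also have "\<dots> = (\<Sum>k<n. \<Sum>i<n. B $$ (k, i) * A $$ (i, k))"
    by (subst sum.swap) (simp add: mult.commute)
  also have "\<dots> = (\<Sum>i<n. (B * A) $$ (i, i))"
    using assms by (intro sum.cong refl mult_mat_index_sum[symmetric]) auto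
  finally show ?thesis .
qed

context banach_in_universe
begin

lemma alg_multiplicity_triangular:
  assumes "triangular N \<phi> a" "\<mu> \<noteq> 0"
  shows "alg_multiplicity s X (rank_sum N \<phi> a) \<mu> = card {i. i < N \<and> \<phi> i (a i) = \<mu>}"
proof -
  obtain B where B: "card B = card {i. i < N \<and> \<phi> i (a i) = \<mu>}" "independent B"
      "span B = gen_eigenspace (rank_sum N \<phi> a) \<mu>"
    using gen_eigenspace_triangular[OF assms] by blast
  have "alg_multiplicity s X (rank_sum N \<phi> a) \<mu> = dim (span B)"
    unfolding B(3) alg_multiplicity_def gen_eigenspace_def ..
  then show ?thesis using dim_span_eq_card_independent[OF B(2)] B(1) by simp
qed

lemma eigenvalue_triangular_iff:
  assumes tri: "triangular N \<phi> a" and mu: "\<mu> \<noteq> 0"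
  shows "\<mu> \<in> eigenvalues s X (rank_sum N \<phi> a) \<longleftrightarrow> (\<exists>i<N. \<phi> i (a i) = \<mu>)"
proof -
  define u where "u = rank_sum N \<phi> a"
  define f where "f = (\<lambda>y. u y - s \<mu> y)"
  have "linear_on_pts u" using tri by (simp add: u_def triangular_def linear_rank_sum)
  then have lin: "linear_on_pts f" unfolding f_def by (rule linear_shift)
  obtain B where B: "finite B" "card B = card {i. i < N \<and> \<phi> i (a i) = \<mu>}" "independent B"
      "span B = gen_eigenspace u \<mu>"
    using gen_eigenspace_triangular[OF assms] unfolding u_def by blast
  have nonempty: "(\<exists>i<N. \<phi> i (a i) = \<mu>) \<longleftrightarrow> B \<noteq> {}"
    using B(1,2) card_eq_0_iff[of B] card_eq_0_iff[of "{i. i < N \<and> \<phi> i (a i) = \<mu>}"] by auto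
  show ?thesis
  proof
    assume "\<mu> \<in> eigenvalues s X (rank_sum N \<phi> a)"
    then obtain x where "x \<in> pts X" "x \<noteq> 0" "(f ^^ 1) x = 0"
      by (auto simp: eigenvalues_def f_def u_def)
    then have "x \<in> span B" "x \<noteq> 0"
      unfolding B(4) gen_eigenspace_def f_def by blast+
    then show "\<exists>i<N. \<phi> i (a i) = \<mu>" using nonempty by auto
  next
    assume "\<exists>i<N. \<phi> i (a i) = \<mu>"
    then obtain x where "x \<in> B" using nonempty by auto
    then have "x \<noteq> 0" "x \<in> gen_eigenspace u \<mu>"
      using B(3,4) dependent_zero span_base by auto
    then obtain n where x: "x \<noteq> 0" "x \<in> pts X" "(f ^^ n) x = 0"
      unfolding gen_eigenspace_def f_def by blast
    define k where "k = (LEAST n. (f ^^ n) x = 0)"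
    have k: "(f ^^ k) x = 0" unfolding k_def by (rule LeastI) (rule x(3))
    with x obtain l where l: "k = Suc l" by (cases k) auto
    have "(f ^^ l) x \<noteq> 0" using not_less_Least[of l "\<lambda>n. (f ^^ n) x = 0"] l k_def by simp
    moreover have "(f ^^ l) x \<in> pts X"
      using linear_on_pts_mem[OF linear_on_pts_funpow[OF lin] x(2)] .
    moreover have "u ((f ^^ l) x) = s \<mu> ((f ^^ l) x)" using k l by (simp add: f_def)
    ultimately show "\<mu> \<in> eigenvalues s X (rank_sum N \<phi> a)"
      unfolding eigenvalues_def u_def by blast
  qed
qed

lemma eigenvalues_triangular:
  assumes "triangular N \<phi> a"
  shows "eigenvalues s X (rank_sum N \<phi> a) - {0} = (\<lambda>i. \<phi> i (a i)) ` {..<N} - {0}"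
  using eigenvalue_triangular_iff[OF assms] by auto

lemma det_one_minus_triangular:
  assumes "triangular N \<phi> a"
  shows "det_one_minus s X (rank_sum N \<phi> a) = (\<Prod>i<N. 1 - \<phi> i (a i))"
proof -
  let ?d = "\<lambda>i. \<phi> i (a i)"
  have "det_one_minus s X (rank_sum N \<phi> a) = (\<Prod>\<mu>\<in>?d ` {..<N} - {0}. (1 - \<mu>) ^ card {i. i < N \<and> ?d i = \<mu>})"
    unfolding det_one_minus_def eigenvalues_triangular[OF assms]
    by (intro prod.cong refl) (simp add: alg_multiplicity_triangular[OF assms])
  also have "\<dots> = (\<Prod>\<mu>\<in>?d ` {..<N}. (1 - \<mu>) ^ card {i. i < N \<and> ?d i = \<mu>})"
    by (intro prod.mono_neutral_left) auto
  also have "\<dots> = (\<Prod>\<mu>\<in>?d ` {..<N}. \<Prod>i\<in>{i\<in>{..<N}. ?d i = \<mu>}. 1 - ?d i)"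
    by (intro prod.cong refl) simp
  also have "\<dots> = (\<Prod>i<N. 1 - ?d i)"
    by (rule prod.image_gen[symmetric]) simp
  finally show ?thesis .
qed

text \<open>
  The sum of the diagonal entries is the sum of the eigenvalues. The right-hand side depends on the
  operator only, which shows below that the trace does not depend on the representation.
\<close>

lemma diagonal_sum_triangular:
  assumes "triangular N \<phi> a"
  shows "(\<Sum>i<N. \<phi> i (a i)) = (\<Sum>\<mu>\<in>eigenvalues s X (rank_sum N \<phi> a) - {0}.
           of_nat (alg_multiplicity s X (rank_sum N \<phi> a) \<mu>) * \<mu>)"
proof -
  let ?d = "\<lambda>i. \<phi> i (a i)"
  have "(\<Sum>\<mu>\<in>eigenvalues s X (rank_sum N \<phi> a) - {0}.
           of_nat (alg_multiplicity s X (rank_sum N \<phi> a) \<mu>) * \<mu>) =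
        (\<Sum>\<mu>\<in>?d ` {..<N} - {0}. of_nat (card {i. i < N \<and> ?d i = \<mu>}) * \<mu>)"
    unfolding eigenvalues_triangular[OF assms]
    by (intro sum.cong refl) (simp add: alg_multiplicity_triangular[OF assms])
  also have "\<dots> = (\<Sum>\<mu>\<in>?d ` {..<N}. of_nat (card {i. i < N \<and> ?d i = \<mu>}) * \<mu>)"
    by (intro sum.mono_neutral_left) auto
  also have "\<dots> = (\<Sum>\<mu>\<in>?d ` {..<N}. \<Sum>i\<in>{i\<in>{..<N}. ?d i = \<mu>}. ?d i)"
    by (intro sum.cong refl) simp
  also have "\<dots> = (\<Sum>i<N. ?d i)"
    by (rule sum.image_gen[symmetric]) simp
  finally show ?thesis ..
qed

text \<open>
  If \<open>u\<close> is the operator of a system, then \<open>u\<close> maps the vector with coordinates \<open>c\<close> to the vector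
  with coordinates \<open>M c\<close>, where \<open>M\<close> is this matrix.
\<close>

definition system_matrix :: "nat \<Rightarrow> (nat \<Rightarrow> 'u \<Rightarrow> complex) \<Rightarrow> (nat \<Rightarrow> 'u) \<Rightarrow> complex mat" where
  "system_matrix N \<phi> a = mat N N (\<lambda>(i, j). \<phi> i (a j))"

lemma system_matrix_carrier [simp]: "system_matrix N \<phi> a \<in> carrier_mat N N"
  by (simp add: system_matrix_def)

lemma system_matrix_index: "i < N \<Longrightarrow> j < N \<Longrightarrow> system_matrix N \<phi> a $$ (i, j) = \<phi> i (a j)"
  by (simp add: system_matrix_def)

text \<open>
  Schur's theorem for the matrix of a system: a change of basis in the coordinates makes the system
  triangular without changing the operator.
\<close>

lemma triangularise:
  assumes sys: "system N \<phi> a"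
  obtains \<phi>' a' where "triangular N \<phi>' a'" "rank_sum N \<phi>' a' = rank_sum N \<phi> a"
    "(\<Sum>i<N. \<phi>' i (a' i)) = (\<Sum>i<N. \<phi> i (a i))"
    "det (1\<^sub>m N - system_matrix N \<phi> a) = (\<Prod>i<N. 1 - \<phi>' i (a' i))"
proof -
  define M where "M = system_matrix N \<phi> a"
  have M: "M \<in> carrier_mat N N" by (simp add: M_def)
  obtain es where es: "char_poly M = (\<Prod>e\<leftarrow>es. [:- e, 1:])"
    using char_poly_factorized[OF M] by blast
  obtain B P Q where "schur_decomposition M es = (B, P, Q)" by (metis prod_cases3)
  from schur_decomposition[OF M es this]
  have sim: "similar_mat_wit M B P Q" and up: "upper_triangular B" by auto
  have PQ: "P * Q = 1\<^sub>m N" and QP: "Q * P = 1\<^sub>m N" and MB: "M = P * B * Q"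
    and B: "B \<in> carrier_mat N N" and P: "P \<in> carrier_mat N N" and Q: "Q \<in> carrier_mat N N"
    using similar_mat_witD2[OF M sim] by auto
  have BM: "B = Q * (M * P)"
  proof -
    have "Q * (M * P) = (Q * P) * B * (Q * P)"
      using B P Q by (simp add: MB assoc_mult_mat[of _ N N _ N _ N])
    then show ?thesis using B by (simp add: QP)
  qed
  have PQ_entry: "(\<Sum>j<N. P $$ (l, j) * Q $$ (j, k)) = (if l = k then 1 else 0)" if "l < N" "k < N" for l k
    using that mult_mat_index_sum[OF P Q that] by (simp add: PQ)
  define a' where "a' j = (\<Sum>l<N. s (P $$ (l, j)) (a l))" for j
  define \<phi>' where "\<phi>' i = (\<lambda>x. \<Sum>k<N. Q $$ (i, k) * \<phi> k x)" for i
  have sys': "system N \<phi>' a'"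
    using sys unfolding system_def a'_def \<phi>'_def by (auto intro!: dual_sum pts_sum)
  have phia: "\<phi> k (a' j) = (M * P) $$ (k, j)" if "k < N" "j < N" for k j
  proof -
    have "\<phi> k (a' j) = (\<Sum>l<N. \<phi> k (s (P $$ (l, j)) (a l)))"
      unfolding a'_def using sys that by (intro dual_apply_sum) (auto simp: system_def)
    also have "\<dots> = (\<Sum>l<N. M $$ (k, l) * P $$ (l, j))"
      using sys that by (intro sum.cong refl) (simp add: dual_scale systemD M_def system_matrix_index)
    also have "\<dots> = (M * P) $$ (k, j)"
      using mult_mat_index_sum[OF M P that] by simp
    finally show ?thesis .
  qed
  have entry: "\<phi>' i (a' j) = B $$ (i, j)" if "i < N" "j < N" for i j
  proof -
    have MP: "M * P \<in> carrier_mat N N" using M P by simp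
    have "\<phi>' i (a' j) = (\<Sum>k<N. Q $$ (i, k) * (M * P) $$ (k, j))"
      unfolding \<phi>'_def using that by (intro sum.cong refl) (simp add: phia)
    also have "\<dots> = B $$ (i, j)"
      unfolding BM using mult_mat_index_sum[OF Q MP that] by simp
    finally show ?thesis .
  qed
  have tri: "triangular N \<phi>' a'"
    unfolding triangular_def using sys' entry up B by (auto simp: upper_triangular_def)
  have "rank_sum N \<phi>' a' x = rank_sum N \<phi> a x" for x
  proof -
    have "rank_sum N \<phi>' a' x = (\<Sum>j<N. \<Sum>l<N. \<Sum>k<N. s (P $$ (l, j) * Q $$ (j, k) * \<phi> k x) (a l))"
      unfolding rank_sum_def a'_def \<phi>'_def
      by (intro sum.cong refl) (simp add: scale_sum_left scale_sum_right sum_distrib_left mult_ac)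
    also have "\<dots> = (\<Sum>l<N. \<Sum>k<N. \<Sum>j<N. s (P $$ (l, j) * Q $$ (j, k) * \<phi> k x) (a l))"
      by (subst sum.swap) (rule sum.cong[OF refl], rule sum.swap)
    also have "\<dots> = (\<Sum>l<N. \<Sum>k<N. s ((\<Sum>j<N. P $$ (l, j) * Q $$ (j, k)) * \<phi> k x) (a l))"
      by (simp only: scale_sum_left sum_distrib_right)
    also have "\<dots> = (\<Sum>l<N. \<Sum>k<N. if l = k then s (\<phi> k x) (a l) else 0)"
      by (intro sum.cong refl) (simp add: PQ_entry)
    also have "\<dots> = rank_sum N \<phi> a x"
      by (simp add: rank_sum_def)
    finally show ?thesis .
  qed
  then have rank: "rank_sum N \<phi>' a' = rank_sum N \<phi> a" by (rule ext)
  have "(\<Sum>i<N. \<phi>' i (a' i)) = (\<Sum>i<N. (Q * (M * P)) $$ (i, i))"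
    using entry BM by simp
  also have "\<dots> = (\<Sum>i<N. (M * P * Q) $$ (i, i))"
    using M P Q by (intro trace_mult_commute) auto
  also have "M * P * Q = M"
    using M P Q PQ by (simp add: assoc_mult_mat[of _ N N _ N _ N])
  finally have tr: "(\<Sum>i<N. \<phi>' i (a' i)) = (\<Sum>i<N. \<phi> i (a i))"
    by (simp add: M_def system_matrix_index)
  have "P * (1\<^sub>m N - B) * Q = 1\<^sub>m N - M"
    using B P Q PQ by (simp add: MB mult_minus_distrib_mat[of _ N N _ N] minus_mult_distrib_mat[of _ N N _ _ N])
  then have "similar_mat_wit (1\<^sub>m N - M) (1\<^sub>m N - B) P Q"
    using M B P Q by (intro similar_mat_witI[OF PQ QP]) auto
  then have "det (1\<^sub>m N - M) = det (1\<^sub>m N - B)"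
    by (intro det_similar) (auto simp: similar_mat_def)
  also have "\<dots> = prod_list (diag_mat (1\<^sub>m N - B))"
    using up B by (intro det_upper_triangular) (auto simp: upper_triangular_def)
  also have "\<dots> = (\<Prod>i<N. 1 - \<phi>' i (a' i))"
    unfolding prod_list_diag_prod using B entry by (auto simp: lessThan_atLeast0 intro!: prod.cong)
  finally have "det (1\<^sub>m N - system_matrix N \<phi> a) = (\<Prod>i<N. 1 - \<phi>' i (a' i))"
    by (simp add: M_def)
  then show ?thesis using that tri rank tr by blast
qed

lemma det_one_minus_eq_det:
  assumes "system N \<phi> a"
  shows "det_one_minus s X (rank_sum N \<phi> a) = det (1\<^sub>m N - system_matrix N \<phi> a)"
  proof -
  obtain \<phi>' a' where "triangular N \<phi>' a'" "rank_sum N \<phi>' a' = rank_sum N \<phi> a"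
    "det (1\<^sub>m N - system_matrix N \<phi> a) = (\<Prod>i<N. 1 - \<phi>' i (a' i))"
    using triangularise[OF assms] by blast
  then show ?thesis using det_one_minus_triangular[of N \<phi>' a'] by simp
qed

lemma op_trace_eq:
  assumes "system N \<phi> a"
  shows "op_trace s X (rank_sum N \<phi> a) = (\<Sum>i<N. \<phi> i (a i))"
proof -
  define t where "t u = (\<Sum>\<mu>\<in>eigenvalues s X u - {0}. of_nat (alg_multiplicity s X u \<mu>) * \<mu>)" for u
  have t_eq: "(\<Sum>i<N. \<phi> i (a i)) = t (rank_sum N \<phi> a)" if sys: "system N \<phi> a" for N \<phi> a
  proof -
    obtain \<phi>' a' where "triangular N \<phi>' a'" "rank_sum N \<phi>' a' = rank_sum N \<phi> a"
      "(\<Sum>i<N. \<phi>' i (a' i)) = (\<Sum>i<N. \<phi> i (a i))"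
      using triangularise[OF sys] by blast
    then show ?thesis using diagonal_sum_triangular[of N \<phi>' a'] by (simp add: t_def)
  qed
  show ?thesis
    unfolding op_trace_def finite_rank_rep_iff
  proof (rule the_equality)
    show "\<exists>N' \<psi> b. (system N' \<psi> b \<and> rank_sum N \<phi> a = rank_sum N' \<psi> b) \<and>
        (\<Sum>i<N. \<phi> i (a i)) = (\<Sum>k<N'. \<psi> k (b k))"
      using assms by blast
    show "r = (\<Sum>i<N. \<phi> i (a i))"
      if "\<exists>N' \<psi> b. (system N' \<psi> b \<and> rank_sum N \<phi> a = rank_sum N' \<psi> b) \<and>
        r = (\<Sum>k<N'. \<psi> k (b k))" for r
      using that t_eq assms by metis
  qed
qed

section \<open>Bounded and finite rank operators\<close>

lemma bounded_ops_linear: "T \<in> bounded_ops s X X \<Longrightarrow> linear_on_pts T"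
  by (simp add: bounded_ops_def linear_on_pts_def)

lemma bounded_ops_outside: "T \<in> bounded_ops s X X \<Longrightarrow> x \<notin> pts X \<Longrightarrow> T x = 0"
  by (simp add: bounded_ops_def)

lemma id_op_bounded: "id_op X \<in> bounded_ops s X X"
  by (auto simp: bounded_ops_def id_op_def intro!: exI[of _ 1])

lemma finite_rank_ops_iff: "u \<in> finite_rank_ops s X \<longleftrightarrow> (\<exists>N \<phi> a. system N \<phi> a \<and> u = rank_sum N \<phi> a)"
  by (simp add: finite_rank_ops_def finite_rank_rep_iff)

lemma finite_rank_linear: "u \<in> finite_rank_ops s X \<Longrightarrow> linear_on_pts u"
  by (auto simp: finite_rank_ops_iff linear_rank_sum)

lemma rank_sum_outside: "system N \<phi> a \<Longrightarrow> x \<notin> pts X \<Longrightarrow> rank_sum N \<phi> a x = 0"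
  by (simp add: rank_sum_def systemD dual_outside)

lemma dual_lincomb:
  assumes "\<phi> \<in> dual s X" "\<psi> \<in> dual s X"
  shows "(\<lambda>x. \<phi> x + c * \<psi> x) \<in> dual s X"
  using dual_sum[of "{0, 1::nat}" "\<lambda>i. if i = 0 then \<phi> else \<psi>" "\<lambda>i. if i = 0 then 1 else c"] assms
  by simp

lemma dual_zero: "(\<lambda>_. 0) \<in> dual s X"
  using dual_sum[of "{}"] by simp

text \<open>Two finite rank operators can be written with the same vectors.\<close>

lemma common_vectors:
  assumes "u \<in> finite_rank_ops s X" "v \<in> finite_rank_ops s X"
  obtains N \<phi> \<psi> a where "system N \<phi> a" "system N \<psi> a" "u = rank_sum N \<phi> a" "v = rank_sum N \<psi> a"
proof -
  obtain N1 \<phi> a where u: "system N1 \<phi> a" "u = rank_sum N1 \<phi> a"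
    using assms(1) unfolding finite_rank_ops_iff by blast
  obtain N2 \<psi> b where v: "system N2 \<psi> b" "v = rank_sum N2 \<psi> b"
    using assms(2) unfolding finite_rank_ops_iff by blast
  define c where "c k = (if k < N1 then a k else b (k - N1))" for k
  define \<phi>' where "\<phi>' k = (if k < N1 then \<phi> k else (\<lambda>_. 0))" for k
  define \<psi>' where "\<psi>' k = (if k < N1 then (\<lambda>_. 0) else \<psi> (k - N1))" for k
  have split: "(\<Sum>k<N1 + n. f k) = (\<Sum>k<N1. f k) + (\<Sum>k<n. f (N1 + k))" for f :: "nat \<Rightarrow> 'u" and n
    by (induction n) (simp_all add: algebra_simps)
  have "system (N1 + N2) \<phi>' c" "system (N1 + N2) \<psi>' c"
    using u(1) v(1) dual_zero by (auto simp: system_def c_def \<phi>'_def \<psi>'_def)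
  moreover have "u = rank_sum (N1 + N2) \<phi>' c" "v = rank_sum (N1 + N2) \<psi>' c"
    by (simp_all add: u(2) v(2) rank_sum_def split c_def \<phi>'_def \<psi>'_def)
  ultimately show ?thesis using that by blast
qed

lemma finite_rank_lincomb:
  assumes "u \<in> finite_rank_ops s X" "v \<in> finite_rank_ops s X"
  shows "(\<lambda>x. u x + s c (v x)) \<in> finite_rank_ops s X"
proof -
  obtain N \<phi> \<psi> a where *: "system N \<phi> a" "system N \<psi> a" "u = rank_sum N \<phi> a" "v = rank_sum N \<psi> a"
    by (rule common_vectors[OF assms])
  have "(\<lambda>x. u x + s c (v x)) = rank_sum N (\<lambda>k x. \<phi> k x + c * \<psi> k x) a"
    by (simp add: * rank_sum_def scale_left_distrib sum.distrib scale_sum_right)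
  moreover have "system N (\<lambda>k x. \<phi> k x + c * \<psi> k x) a"
    using * by (auto simp: system_def intro: dual_lincomb)
  ultimately show ?thesis unfolding finite_rank_ops_iff by blast
qed

lemma finite_rank_diff:
  assumes "u \<in> finite_rank_ops s X" "v \<in> finite_rank_ops s X"
  shows "(\<lambda>x. u x - v x) \<in> finite_rank_ops s X"
  using finite_rank_lincomb[OF assms, of "-1"] by simp

lemma comp_rank_sum:
  assumes T: "linear_on_pts T" and sys: "system N \<phi> a"
  shows "T \<circ> rank_sum N \<phi> a = rank_sum N \<phi> (\<lambda>k. T (a k))" "system N \<phi> (\<lambda>k. T (a k))"
proof -
  show "system N \<phi> (\<lambda>k. T (a k))"
    using sys linear_on_pts_mem[OF T] by (simp add: system_def)
  have "T (rank_sum N \<phi> a x) = (\<Sum>k<N. T (s (\<phi> k x) (a k)))" for x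
    unfolding rank_sum_def using sys by (intro linear_on_pts_sum[OF T]) (simp add: systemD)
  then show "T \<circ> rank_sum N \<phi> a = rank_sum N \<phi> (\<lambda>k. T (a k))"
    using sys by (simp add: fun_eq_iff linear_on_pts_scale[OF T] systemD rank_sum_def)
qed

lemma finite_rank_comp:
  assumes "linear_on_pts T" "u \<in> finite_rank_ops s X"
  shows "T \<circ> u \<in> finite_rank_ops s X"
  using assms comp_rank_sum finite_rank_ops_iff by metis

text \<open>
  With common vectors \<open>a\<close>, the matrices of \<open>g\<close>, \<open>w\<close> and \<open>g w\<close> are \<open>M\<close>, \<open>M'\<close> and \<open>M M'\<close>, so that
  the matrix identity \<open>1 - (M + M' - M M') = (1 - M) (1 - M')\<close> gives multiplicativity.
\<close>

lemma det_one_minus_mult: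
  assumes "g \<in> finite_rank_ops s X" "w \<in> finite_rank_ops s X"
  shows "det_one_minus s X (\<lambda>x. g x + w x - g (w x)) = det_one_minus s X g * det_one_minus s X w"
proof -
  obtain N \<phi> \<psi> a where *: "system N \<phi> a" "system N \<psi> a" "g = rank_sum N \<phi> a" "w = rank_sum N \<psi> a"
    by (rule common_vectors[OF assms])
  define \<theta> where "\<theta> k x = \<phi> k x + \<psi> k x - \<phi> k (w x)" for k x
  have phi_w: "\<phi> k (w x) = (\<Sum>l<N. \<phi> k (a l) * \<psi> l x)" if "k < N" for k x
    unfolding *(4) using dual_rank_sum[OF *(2) systemD(1)[OF *(1) that]] by (simp add: mult.commute)
  have "\<theta> k \<in> dual s X" if k: "k < N" for k
  proof -
    have "\<theta> k = (\<lambda>x. (\<phi> k x + 1 * \<psi> k x) + (- 1) * (\<Sum>l<N. \<phi> k (a l) * \<psi> l x))"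
      using phi_w[OF k] by (simp add: \<theta>_def fun_eq_iff)
    then show ?thesis
      using k *(1,2) by (simp only:) (intro dual_lincomb dual_sum; simp add: systemD)
  qed
  then have sys: "system N \<theta> a" using *(1) by (simp add: system_def)
  have rank: "(\<lambda>x. g x + w x - g (w x)) = rank_sum N \<theta> a"
    unfolding *(3) by (simp add: *(4) rank_sum_def \<theta>_def scale_left_distrib scale_left_diff_distrib
        sum.distrib sum_subtractf fun_eq_iff)
  let ?A = "1\<^sub>m N - system_matrix N \<phi> a" and ?B = "1\<^sub>m N - system_matrix N \<psi> a"
  have carrier: "?A \<in> carrier_mat N N" "?B \<in> carrier_mat N N"
    by (intro minus_carrier_mat system_matrix_carrier)+
  have "1\<^sub>m N - system_matrix N \<theta> a = ?A * ?B"
  proof (rule eq_matI)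
    fix i j assume "i < dim_row (?A * ?B)" "j < dim_col (?A * ?B)"
    then have ij: "i < N" "j < N" by (auto simp: system_matrix_def)
    have "(?A * ?B) $$ (i, j) = (\<Sum>k<N. ((if i = k then 1 else 0) - \<phi> i (a k)) * ((if k = j then 1 else 0) - \<psi> k (a j)))"
      unfolding mult_mat_index_sum[OF carrier ij] using ij
      by (intro sum.cong refl) (simp add: system_matrix_def)
    also have "\<dots> = (\<Sum>k<N. (if k = i then (if i = j then 1 else 0) - \<psi> i (a j) else 0)
         - (if k = j then \<phi> i (a j) else 0) + \<phi> i (a k) * \<psi> k (a j))"
      by (intro sum.cong refl) (auto simp: algebra_simps)
    also have "\<dots> = (if i = j then 1 else 0) - \<psi> i (a j) - \<phi> i (a j) + \<phi> i (w (a j))"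
      using ij by (simp add: sum.distrib sum_subtractf phi_w)
    finally show "(1\<^sub>m N - system_matrix N \<theta> a) $$ (i, j) = (?A * ?B) $$ (i, j)"
      using ij by (simp add: system_matrix_def \<theta>_def)
  qed (auto simp: system_matrix_def)
  then show ?thesis
    using det_mult[OF carrier] rank * det_one_minus_eq_det[OF sys]
      det_one_minus_eq_det[OF *(1)] det_one_minus_eq_det[OF *(2)] by simp
qed

section \<open>The inverse of \<open>1 - h\<close> for a contraction \<open>h\<close>\<close>

text \<open>A contraction \<open>h\<close> leaves \<open>1 - h\<close> bounded below.\<close>

lemma norm_le_of_contraction:
  assumes h: "linear_on_pts h" "\<And>x. x \<in> pts X \<Longrightarrow> nrm X (h x) \<le> r * nrm X x" and r: "r < 1"
    and y: "y \<in> pts X"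
  shows "nrm X y \<le> nrm X (y - h y) / (1 - r)"
proof -
  have "nrm X y \<le> nrm X (y - h y) + nrm X (h y)"
    using nrm_triangle[of "y - h y" "h y"] y linear_on_pts_mem[OF h(1) y] by simp
  then have "(1 - r) * nrm X y \<le> nrm X (y - h y)"
    using h(2)[OF y] by (simp add: algebra_simps)
  then show ?thesis using r by (simp add: field_simps)
qed

lemma contraction_solve:
  assumes h: "linear_on_pts h" "\<And>x. x \<in> pts X \<Longrightarrow> nrm X (h x) \<le> r * nrm X x" and r: "0 \<le> r" "r < 1"
    and x: "x \<in> pts X"
  shows "\<exists>y\<in>pts X. y - h y = x"
proof -
  note hm = linear_on_pts_mem[OF h(1)]
  \<comment> \<open>The fixed point of \<open>y \<mapsto> x + h y\<close> is found by iteration from 0.\<close>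
  define F where "F y = x + h y" for y
  define y where "y n = (F ^^ n) 0" for n
  have y0: "y 0 = 0" and yS: "y (Suc n) = x + h (y n)" for n
    by (simp_all add: y_def F_def)
  have yX: "y n \<in> pts X" for n
    by (induction n) (simp_all add: y0 yS x hm)
  define K where "K = nrm X x / (1 - r)"
  have K: "nrm X x + r * K = K" using r by (simp add: K_def field_simps)
  have bound: "nrm X (y n) \<le> K" for n
  proof (induction n)
    case 0
    then show ?case using r x by (simp add: y0 K_def)
  next
    case (Suc n)
    have "nrm X (y (Suc n)) \<le> nrm X x + r * nrm X (y n)"
      unfolding yS using nrm_triangle[OF x hm[OF yX]] h(2)[OF yX] by (meson add_left_mono order_trans)
    also have "\<dots> \<le> nrm X x + r * K" using Suc r by (simp add: mult_left_mono)
    finally show ?case using K by simp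
  qed
  \<comment> \<open>The \<open>n\<close>-fold application of \<open>h\<close> carries \<open>y k - y 0\<close> to \<open>y (n + k) - y n\<close>.\<close>
  have step: "nrm X (y (n + k) - y n) \<le> r ^ n * K" for n k
  proof (induction n)
    case 0
    then show ?case using bound by (simp add: y0)
  next
    case (Suc n)
    have "y (Suc n + k) - y (Suc n) = h (y (n + k) - y n)"
      by (simp add: yS linear_on_pts_diff[OF h(1)] yX)
    then have "nrm X (y (Suc n + k) - y (Suc n)) \<le> r * nrm X (y (n + k) - y n)"
      using h(2)[of "y (n + k) - y n"] yX by simp
    also have "\<dots> \<le> r * (r ^ n * K)" using Suc r by (intro mult_left_mono) auto
    finally show ?case by (simp add: mult.assoc)
  qed
  have "(\<lambda>n. r ^ n * K) \<longlonglongrightarrow> 0 * K"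
    using r by (intro tendsto_mult tendsto_const LIMSEQ_power_zero) simp
  then have lim0: "(\<lambda>n. r ^ n * K) \<longlonglongrightarrow> 0" by simp
  have "\<exists>M. \<forall>m\<ge>M. \<forall>n\<ge>M. nrm X (y m - y n) < e" if "e > 0" for e
  proof -
    obtain M where M: "\<And>n. n \<ge> M \<Longrightarrow> r ^ n * K < e"
      using order_tendstoD(2)[OF lim0 \<open>e > 0\<close>] by (auto simp: eventually_sequentially)
    have *: "nrm X (y m - y n) < e" if "m \<ge> n" "n \<ge> M" for m n
      using step[of n "m - n"] M[OF that(2)] that(1) by simp
    have "nrm X (y m - y n) < e" if "m \<ge> M" "n \<ge> M" for m n
      using *[of m n] *[of n m] nrm_diff_commute[OF yX yX, of m n] that by (cases "m \<ge> n") auto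
    then show ?thesis by blast
  qed
  with yX obtain l where l: "l \<in> pts X" "(\<lambda>n. nrm X (y n - l)) \<longlonglongrightarrow> 0"
    using nrm_complete[of y] by blast
  have le: "nrm X (l - h l - x) \<le> nrm X (y (Suc n) - l) + r * nrm X (y n - l)" for n
  proof -
    have "l - h l - x = (l - y (Suc n)) + h (y n - l)"
      by (simp add: yS linear_on_pts_diff[OF h(1)] yX l)
    then have "nrm X (l - h l - x) \<le> nrm X (l - y (Suc n)) + nrm X (h (y n - l))"
      unfolding \<open>l - h l - x = _\<close> using yX l hm by (intro nrm_triangle) auto
    also have "\<dots> \<le> nrm X (y (Suc n) - l) + r * nrm X (y n - l)"
      using h(2)[of "y n - l"] yX l nrm_diff_commute[OF l(1) yX] by simp
    finally show ?thesis .
  qed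
  have "(\<lambda>n. nrm X (y (Suc n) - l) + r * nrm X (y n - l)) \<longlonglongrightarrow> 0 + r * 0"
    by (intro tendsto_intros LIMSEQ_Suc l)
  then have "nrm X (l - h l - x) \<le> 0 + r * 0"
    by (rule LIMSEQ_le_const) (use le in blast)
  moreover have "l - h l - x \<in> pts X" using l x hm by simp
  ultimately have "nrm X (l - h l - x) = 0" using nrm_nonneg[of "l - h l - x"] by linarith
  then have "l - h l = x" using nrm_eq_0_iff[of "l - h l - x"] l x hm by simp
  then show ?thesis using l(1) by blast
qed

lemma contraction_inverse:
  assumes h: "linear_on_pts h" "\<And>x. x \<in> pts X \<Longrightarrow> nrm X (h x) \<le> r * nrm X x" and r: "0 \<le> r" "r < 1"
  obtains B where "B \<in> bounded_ops s X X" "\<And>x. x \<in> pts X \<Longrightarrow> B x - h (B x) = x"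
    "\<And>x. x \<in> pts X \<Longrightarrow> nrm X (B x) \<le> nrm X x / (1 - r)"
proof -
  have "\<forall>x\<in>pts X. \<exists>y\<in>pts X. y - h y = x"
    using contraction_solve[OF h r] by blast
  then obtain B0 where B0: "\<And>x. x \<in> pts X \<Longrightarrow> B0 x \<in> pts X \<and> B0 x - h (B0 x) = x"
    by metis
  define B where "B x = (if x \<in> pts X then B0 x else 0)" for x
  have B: "B x \<in> pts X" "B x - h (B x) = x" if "x \<in> pts X" for x
    using B0[OF that] that by (auto simp: B_def)
  have uniq: "y = z" if "y \<in> pts X" "z \<in> pts X" "y - h y = z - h z" for y z
  proof -
    have "(y - z) - h (y - z) = 0" using that by (simp add: linear_on_pts_diff[OF h(1)] algebra_simps)
    then have "nrm X (y - z) \<le> 0"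
      using norm_le_of_contraction[OF h r(2), of "y - z"] that by simp
    then have "nrm X (y - z) = 0" using that by (intro antisym nrm_nonneg pts_diff)
    then have "y - z = 0" using nrm_eq_0_iff[OF pts_diff[OF that(1,2)]] by blast
    then show ?thesis by simp
  qed
  have norm: "nrm X (B x) \<le> nrm X x / (1 - r)" if "x \<in> pts X" for x
    using norm_le_of_contraction[OF h r(2), of "B x"] B[OF that] by simp
  have add: "B (x + y) = B x + B y" if "x \<in> pts X" "y \<in> pts X" for x y
  proof (rule uniq)
    have "B x + B y - h (B x + B y) = (B x - h (B x)) + (B y - h (B y))"
      using that B(1) by (simp add: linear_on_pts_add[OF h(1)])
    then show "B (x + y) - h (B (x + y)) = B x + B y - h (B x + B y)"
      using that B by simp
  qed (use that B in auto)
  have scale: "B (s c x) = s c (B x)" if "x \<in> pts X" for c x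
  proof (rule uniq)
    have "s c (B x) - h (s c (B x)) = s c (B x - h (B x))"
      using that B(1) by (simp add: linear_on_pts_scale[OF h(1)] scale_right_diff_distrib)
    then show "B (s c x) - h (B (s c x)) = s c (B x) - h (s c (B x))"
      using that B by simp
  qed (use that B in auto)
  have "B \<in> bounded_ops s X X"
    unfolding bounded_ops_def using B norm add scale
    by (auto simp: B_def intro!: exI[of _ "1 / (1 - r)"])
  then show ?thesis using that B norm by blast
qed

section \<open>Power sums of the eigenvalues\<close>

text \<open>Powers of a triangular matrix are triangular, with the powers of the diagonal entries.\<close>

lemma functional_power_triangular:
  assumes tri: "triangular N \<phi> a" and "i < N" "j \<le> i"
  shows "\<phi> i ((rank_sum N \<phi> a ^^ k) (a j)) = (if i = j then \<phi> i (a i) ^ Suc k else 0)"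
  using assms(2,3)
proof (induction k arbitrary: i)
  case 0
  then show ?case using tri by (auto simp: triangular_def)
next
  case (Suc k)
  let ?u = "rank_sum N \<phi> a"
  have sys: "system N \<phi> a" using tri by (simp add: triangular_def)
  have "\<phi> i ((?u ^^ Suc k) (a j)) = (\<Sum>l<N. \<phi> l ((?u ^^ k) (a j)) * \<phi> i (a l))"
    using dual_rank_sum[OF sys systemD(1)[OF sys Suc.prems(1)]] by simp
  also have "\<dots> = (\<Sum>l<N. if l = i then (if i = j then \<phi> i (a i) ^ Suc k * \<phi> i (a i) else 0) else 0)"
  proof (intro sum.cong refl)
    fix l assume l: "l \<in> {..<N}"
    show "\<phi> l ((?u ^^ k) (a j)) * \<phi> i (a l) =
        (if l = i then (if i = j then \<phi> i (a i) ^ Suc k * \<phi> i (a i) else 0) else 0)"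
    proof (cases "l < i")
      case True
      then have "\<phi> i (a l) = 0" using tri Suc.prems by (simp add: triangular_def)
      then show ?thesis using True by simp
    next
      case False
      then show ?thesis using Suc.IH[of l] l Suc.prems by auto
    qed
  qed
  also have "\<dots> = (if i = j then \<phi> i (a i) ^ Suc (Suc k) else 0)"
    using Suc.prems by (simp add: mult.commute)
  finally show ?case .
qed

lemma funpow_finite_rank:
  assumes "system N \<phi> a"
  shows "rank_sum N \<phi> a ^^ Suc k = rank_sum N \<phi> (\<lambda>i. (rank_sum N \<phi> a ^^ k) (a i))"
    "system N \<phi> (\<lambda>i. (rank_sum N \<phi> a ^^ k) (a i))"
proof -
  note * = comp_rank_sum[OF linear_on_pts_funpow[OF linear_rank_sum[OF assms]] assms, of k]
  show "system N \<phi> (\<lambda>i. (rank_sum N \<phi> a ^^ k) (a i))" by (rule *(2))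
  show "rank_sum N \<phi> a ^^ Suc k = rank_sum N \<phi> (\<lambda>i. (rank_sum N \<phi> a ^^ k) (a i))"
    unfolding *(1)[symmetric] by (simp add: fun_eq_iff funpow_swap1)
qed

lemma op_trace_power_triangular:
  assumes tri: "triangular N \<phi> a"
  shows "op_trace s X (rank_sum N \<phi> a ^^ Suc k) = (\<Sum>i<N. \<phi> i (a i) ^ Suc k)"
proof -
  have sys: "system N \<phi> a" using tri by (simp add: triangular_def)
  show ?thesis
    unfolding funpow_finite_rank(1)[OF sys] op_trace_eq[OF funpow_finite_rank(2)[OF sys]]
    using functional_power_triangular[OF tri] by simp
qed

text \<open>
  If the traces of the powers of a contraction of finite rank decay geometrically, then the logarithm
  \<open>-\<Sum> trace (w^k) / k\<close> of its determinant is controlled.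
\<close>

lemma det_one_minus_exp:
  assumes w: "w \<in> finite_rank_ops s X" "\<And>x. x \<in> pts X \<Longrightarrow> nrm X (w x) \<le> r * nrm X x"
    and r: "0 \<le> r" "r < 1"
    and tr: "\<And>k. cmod (op_trace s X (w ^^ Suc k)) \<le> c * r ^ k"
  shows "\<exists>z. det_one_minus s X w = exp z \<and> cmod z \<le> c / (1 - r)"
proof -
  obtain N \<phi> a where tri: "triangular N \<phi> a" and w_eq: "w = rank_sum N \<phi> a"
    using w(1) triangularise unfolding finite_rank_ops_iff by metis
  define d where "d i = \<phi> i (a i)" for i
  have d: "cmod (d i) \<le> r" if "i < N" for i
  proof (cases "d i = 0")
    case False
    then have "d i \<in> eigenvalues s X w"
      unfolding w_eq using eigenvalue_triangular_iff[OF tri] that by (auto simp: d_def)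
    then obtain x where x: "x \<in> pts X" "x \<noteq> 0" "w x = s (d i) x"
      by (auto simp: eigenvalues_def)
    then have "cmod (d i) * nrm X x \<le> r * nrm X x" using w(2)[OF x(1)] by (simp add: nrm_scale)
    then show ?thesis using nrm_pos[OF x(1,2)] by simp
  qed (use r in simp)
  define z where "z = (\<Sum>i<N. ln (1 - d i))"
  have "(\<lambda>n. - (d i ^ n) / of_nat n) sums ln (1 - d i)" if "i < N" for i
    using Ln_series'[of "- d i"] d[OF that] r by simp
  then have sums: "(\<lambda>n. \<Sum>i<N. - (d i ^ n) / of_nat n) sums z"
    unfolding z_def by (intro sums_sum) auto
  have term_Suc: "(\<Sum>i<N. - (d i ^ Suc k) / of_nat (Suc k)) = - op_trace s X (w ^^ Suc k) / of_nat (Suc k)" for k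
    unfolding w_eq op_trace_power_triangular[OF tri]
    by (simp only: d_def sum_negf sum_divide_distrib minus_divide_left[symmetric])
  \<comment> \<open>The term for \<open>n = 0\<close> can be dropped because the division by 0 yields 0.\<close>
  have "(\<lambda>k. \<Sum>i<N. - (d i ^ Suc k) / of_nat (Suc k)) sums z"
    using sums by (subst sums_Suc_iff) simp
  then have z_sums: "(\<lambda>k. - op_trace s X (w ^^ Suc k) / of_nat (Suc k)) sums z"
    unfolding term_Suc .
  have geo: "(\<lambda>k. c * r ^ k) sums (c * (1 / (1 - r)))"
    using r by (intro sums_mult geometric_sums) simp
  have "norm z \<le> c * (1 / (1 - r))"
  proof (rule norm_sums_le[OF z_sums geo])
    fix k
    have "cmod (op_trace s X (w ^^ Suc k)) / real (Suc k) \<le> cmod (op_trace s X (w ^^ Suc k)) / 1"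
      by (intro divide_left_mono) auto
    then show "norm (- op_trace s X (w ^^ Suc k) / of_nat (Suc k)) \<le> c * r ^ k"
      using tr[of k] by (simp only: norm_divide norm_minus_cancel norm_of_nat div_by_1)
  qed
  moreover have "det_one_minus s X w = exp z"
  proof -
    have "1 - d i \<noteq> 0" if "i < N" for i using d[OF that] r by auto
    then have "exp z = (\<Prod>i<N. 1 - d i)"
      unfolding z_def by (simp add: exp_sum)
    then show ?thesis unfolding w_eq det_one_minus_triangular[OF tri] d_def ..
  qed
  ultimately show ?thesis by auto
qed

end

section \<open>The quasinorm dominates the operator norm\<close>

lemma op_norm_bounds:
  assumes "0 \<in> pts Z" "nrm Z 0 \<le> 1" "T 0 = 0" "nrm Y 0 = 0"
    and "\<And>x. x \<in> pts Z \<Longrightarrow> nrm Z x \<le> 1 \<Longrightarrow> nrm Y (T x) \<le> B"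
  shows "0 \<le> op_norm Z Y T" "op_norm Z Y T \<le> B"
proof -
  have ne: "{x \<in> pts Z. nrm Z x \<le> 1} \<noteq> {}" using assms(1,2) by blast
  have bdd: "bdd_above ((\<lambda>x. nrm Y (T x)) ` {x \<in> pts Z. nrm Z x \<le> 1})"
    using assms(5) by (intro bdd_aboveI[of _ B]) auto
  show "op_norm Z Y T \<le> B"
    unfolding op_norm_def using assms(5) by (intro cSUP_least[OF ne]) auto
  have "nrm Y (T 0) \<le> op_norm Z Y T"
    unfolding op_norm_def using assms(1,2) by (intro cSUP_upper[OF _ bdd]) auto
  then show "0 \<le> op_norm Z Y T" using assms(3,4) by simp
qed

lemma (in banach_in_universe) banach_space_line:
  assumes x: "x \<in> pts X" "x \<noteq> 0"
  shows "banach_space s \<lparr>pts = span {x}, nrm = nrm X\<rparr>"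
proof -
  have nx: "nrm X x > 0" by (rule nrm_pos[OF x])
  have sub: "span {x} \<subseteq> pts X" using x by (intro span_minimal pts_subspace) simp
  have complete: "\<exists>l\<in>span {x}. (\<lambda>n. nrm X (f n - l)) \<longlonglongrightarrow> 0"
    if f: "\<forall>n. f n \<in> span {x}"
      and cauchy: "\<forall>e>0. \<exists>M. \<forall>m\<ge>M. \<forall>n\<ge>M. nrm X (f m - f n) < e" for f :: "nat \<Rightarrow> 'u"
  proof -
    have "\<forall>n. \<exists>c. f n = s c x" using f by (auto simp: span_singleton)
    from choice[OF this] obtain c where c: "\<And>n. f n = s (c n) x" by blast
    have diff: "nrm X (s c x - s d x) = cmod (c - d) * nrm X x" for c d
      using nrm_scale[OF x(1), of "c - d"] by (simp add: scale_left_diff_distrib)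
    have "Cauchy c"
    proof (rule CauchyI)
      fix e :: real assume "e > 0"
      then obtain M where "\<forall>m\<ge>M. \<forall>n\<ge>M. nrm X (f m - f n) < e * nrm X x"
        using cauchy nx by (meson mult_pos_pos)
      then show "\<exists>M. \<forall>m\<ge>M. \<forall>n\<ge>M. norm (c m - c n) < e"
        using nx by (auto simp: c diff)
    qed
    then obtain d where "c \<longlonglongrightarrow> d" using Cauchy_convergent convergent_def by blast
    then have "(\<lambda>n. cmod (c n - d) * nrm X x) \<longlonglongrightarrow> 0 * nrm X x"
      by (intro tendsto_mult tendsto_const) (simp add: LIM_zero tendsto_norm_zero)
    then show ?thesis
      by (intro bexI[of _ "s d x"]) (auto simp: c diff span_base span_scale)
  qed
  show ?thesis
    unfolding banach_space_def nspace.simps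
    using sub complete nrm_triangle nrm_scale subspace_span by (auto simp: subset_iff)
qed

text \<open>A quasinormed operator ideal, considered on one Banach space.\<close>

locale ideal_on_banach = banach_in_universe s X + quasinormed_operator_ideal s A q
  for s :: "complex \<Rightarrow> 'u \<Rightarrow> 'u::ab_group_add"
    and A :: "'u nspace \<Rightarrow> 'u nspace \<Rightarrow> ('u \<Rightarrow> 'u) set"
    and q :: "'u nspace \<Rightarrow> 'u nspace \<Rightarrow> ('u \<Rightarrow> 'u) \<Rightarrow> real"
    and X :: "'u nspace"
begin

lemma ideal_linear: "U \<in> A X X \<Longrightarrow> linear_on_pts U"
  using ideal_bounded[OF banach banach] bounded_ops_linear by blast

lemma ideal_outside: "U \<in> A X X \<Longrightarrow> x \<notin> pts X \<Longrightarrow> U x = 0"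
  using ideal_bounded[OF banach banach] bounded_ops_outside by blast

text \<open>
  For a functional \<open>\<phi>\<close> norming \<open>U x\<close>, the operator \<open>U\<close> factors the multiple \<open>\<phi> (U x)\<close> of the
  identity of the line spanned by \<open>x\<close>.
\<close>

lemma norm_le_quasinorm:
  assumes U: "U \<in> A X X" and x: "x \<in> pts X"
  shows "nrm X (U x) \<le> q X X U * nrm X x"
proof (cases "x = 0")
  case True
  then show ?thesis using linear_on_pts_zero[OF ideal_linear[OF U]] by simp
next
  case False
  define K where "K = \<lparr>pts = span {x}, nrm = nrm X\<rparr>"
  have K: "banach_space s K" unfolding K_def by (rule banach_space_line[OF x False])
  have ptsK: "pts K = span {x}" and nrmK: "nrm K = nrm X" by (simp_all add: K_def)
  have sub: "pts K \<subseteq> pts X" unfolding ptsK using x by (intro span_minimal pts_subspace) simp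
  have dimK: "vector_space.dim s (pts K) = 1"
    unfolding ptsK using dim_span_eq_card_independent[of "{x}"] False by simp
  have Ux: "U x \<in> pts X" using linear_on_pts_mem[OF ideal_linear[OF U] x] .
  obtain \<phi> where phi: "\<phi> \<in> dual s X" "\<And>y. y \<in> pts X \<Longrightarrow> cmod (\<phi> y) \<le> nrm X y"
      "nrm X (U x) \<le> cmod (\<phi> (U x))"
    using ex_norming_functional[OF Ux] by blast
  define S where "S = id_op K"
  define T where "T y = s (\<phi> y) x" for y
  have S: "S \<in> bounded_ops s K X"
    using sub by (auto simp: S_def bounded_ops_def id_op_def nrmK ptsK span_add span_scale
        intro!: exI[of _ 1])
  have nT: "nrm X (T y) \<le> nrm X x * nrm X y" if "y \<in> pts X" for y
    using phi(2)[OF that] x by (simp add: T_def nrm_scale mult.commute mult_left_mono)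
  have T_span: "T y \<in> span {x}" for y by (simp add: T_def span_scale span_base)
  have T: "T \<in> bounded_ops s X K"
    unfolding bounded_ops_def using nT phi(1) T_span
    by (auto simp: T_def ptsK nrmK dual_add dual_scale dual_outside scale_left_distrib)
  have "U (s c x) = s c (U x)" for c
    using linear_on_pts_scale[OF ideal_linear[OF U] x] .
  then have "T (U y) = s (\<phi> (U x)) y" if "y \<in> span {x}" for y
    using that Ux by (auto simp: span_singleton T_def dual_scale[OF phi(1)] mult.commute)
  moreover have "T (U 0) = 0"
    using linear_on_pts_zero[OF ideal_linear[OF U]] dual_apply_zero[OF phi(1)] by (simp add: T_def)
  ultimately have comp: "T \<circ> U \<circ> S = (\<lambda>y. s (\<phi> (U x)) (id_op K y))"
    by (auto simp: S_def id_op_def ptsK)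
  have "cmod (\<phi> (U x)) * q K K (id_op K) = q K K (T \<circ> U \<circ> S)"
    unfolding comp using q_scale[OF K K ideal_id[OF K dimK]] by simp
  also have "\<dots> \<le> op_norm X K T * q X X U * op_norm K X S"
    by (rule q_comp[OF K banach banach K S U T])
  also have "\<dots> \<le> nrm X x * q X X U * 1"
  proof (intro mult_mono mult_nonneg_nonneg)
    show "op_norm X K T \<le> nrm X x"
    proof (rule op_norm_bounds(2))
      show "nrm K (T y) \<le> nrm X x" if "y \<in> pts X" "nrm X y \<le> 1" for y
        using nT[OF that(1)] that x mult_left_mono[OF that(2), of "nrm X x"] by (simp add: nrmK)
    qed (auto simp: T_def nrmK dual_apply_zero[OF phi(1)])
    show "0 \<le> op_norm K X S" "op_norm K X S \<le> 1"
      by (rule op_norm_bounds; use sub in \<open>auto simp: nrmK ptsK S_def id_op_def span_zero\<close>)+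
    show "0 \<le> q X X U" by (rule q_nonneg[OF banach banach U])
  qed (use x q_nonneg[OF banach banach U] in auto)
  finally show ?thesis
    using phi(3) q_id[OF K dimK] by (simp add: mult.commute)
qed

lemma ideal_comp_left:
  assumes T: "T \<in> bounded_ops s X X" "\<And>x. x \<in> pts X \<Longrightarrow> nrm X (T x) \<le> B * nrm X x"
    and B: "B \<ge> 0" and U: "U \<in> A X X"
  shows "T \<circ> U \<in> A X X" "q X X (T \<circ> U) \<le> B * q X X U"
proof -
  have T0: "T 0 = 0" using linear_on_pts_zero[OF bounded_ops_linear[OF T(1)]] .
  have eq: "T \<circ> U \<circ> id_op X = T \<circ> U"
    using ideal_outside[OF U] linear_on_pts_zero[OF ideal_linear[OF U]]
    by (auto simp: id_op_def fun_eq_iff)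
  show "T \<circ> U \<in> A X X"
    using ideal_comp[OF banach banach banach banach id_op_bounded U T(1)] by (simp add: eq)
  have "q X X (T \<circ> U) \<le> op_norm X X T * q X X U * op_norm X X (id_op X)"
    using q_comp[OF banach banach banach banach id_op_bounded U T(1)] by (simp add: eq)
  also have "\<dots> \<le> B * q X X U * 1"
  proof (intro mult_mono mult_nonneg_nonneg)
    show "op_norm X X T \<le> B"
    proof (rule op_norm_bounds(2))
      show "nrm X (T x) \<le> B" if "x \<in> pts X" "nrm X x \<le> 1" for x
        using T(2)[OF that(1)] mult_left_mono[OF that(2) B] by simp
    qed (auto simp: T0)
    show "0 \<le> op_norm X X (id_op X)" "op_norm X X (id_op X) \<le> 1"
      by (rule op_norm_bounds; auto simp: id_op_def)+
    show "0 \<le> q X X U" by (rule q_nonneg[OF banach banach U])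
  qed (use B q_nonneg[OF banach banach U] in auto)
  finally show "q X X (T \<circ> U) \<le> B * q X X U" by simp
qed

lemma ideal_diff:
  assumes "U \<in> A X X" "V \<in> A X X"
  shows "(\<lambda>x. U x - V x) \<in> A X X"
  using ideal_add[OF banach banach assms(1) ideal_scale[OF banach banach assms(2), of "-1"]] by simp

lemma q_diff_commute:
  assumes "U \<in> A X X" "V \<in> A X X"
  shows "q X X (\<lambda>x. U x - V x) = q X X (\<lambda>x. V x - U x)"
  using q_scale[OF banach banach ideal_diff[OF assms], of "-1"] by simp

lemma quasi_triangle:
  "\<exists>C>0. \<forall>U\<in>A X X. \<forall>V\<in>A X X. \<forall>W\<in>A X X.
    q X X (\<lambda>x. U x - W x) \<le> C * (q X X (\<lambda>x. U x - V x) + q X X (\<lambda>x. V x - W x))"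
proof -
  obtain C where C: "\<forall>U\<in>A X X. \<forall>V\<in>A X X. q X X (\<lambda>x. U x + V x) \<le> C * (q X X U + q X X V)"
    using q_add[OF banach banach] by blast
  have "q X X (\<lambda>x. U x - W x) \<le> max C 1 * (q X X (\<lambda>x. U x - V x) + q X X (\<lambda>x. V x - W x))"
    if uvw: "U \<in> A X X" "V \<in> A X X" "W \<in> A X X" for U V W
  proof -
    note d = ideal_diff[OF uvw(1,2)] ideal_diff[OF uvw(2,3)]
    have "q X X (\<lambda>x. U x - W x) \<le> C * (q X X (\<lambda>x. U x - V x) + q X X (\<lambda>x. V x - W x))"
      using bspec[OF bspec[OF C d(1)] d(2)] by simp
    also have "\<dots> \<le> max C 1 * (q X X (\<lambda>x. U x - V x) + q X X (\<lambda>x. V x - W x))"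
      using q_nonneg[OF banach banach d(1)] q_nonneg[OF banach banach d(2)]
      by (intro mult_right_mono) auto
    finally show ?thesis .
  qed
  then show ?thesis by (intro exI[of _ "max C 1"]) simp
qed

lemma power_in_ideal:
  assumes w: "w \<in> A X X" "\<And>x. x \<in> pts X \<Longrightarrow> nrm X (w x) \<le> r * nrm X x" and r: "0 \<le> r"
  shows "w ^^ Suc k \<in> A X X \<and> q X X (w ^^ Suc k) \<le> r ^ k * q X X w"
proof (induction k)
  case 0
  then show ?case using w(1) by simp
next
  case (Suc k)
  have "w \<in> bounded_ops s X X" using ideal_bounded[OF banach banach] w(1) by blast
  note * = ideal_comp_left[OF this w(2) r conjunct1[OF Suc]]
  have "w ^^ Suc (Suc k) = w \<circ> w ^^ Suc k" by (rule funpow.simps(2))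
  moreover have "r * q X X (w ^^ Suc k) \<le> r ^ Suc k * q X X w"
    using mult_left_mono[OF conjunct2[OF Suc] r] by (simp only: power_Suc mult.assoc)
  ultimately show ?case using * by (metis order_trans)
qed

end

section \<open>Continuity of the determinant\<close>

text \<open>The case of a trace that is bounded on the finite rank operators, with bound \<open>b\<close>.\<close>

locale ideal_with_trace = ideal_on_banach s A q X
  for s :: "complex \<Rightarrow> 'u \<Rightarrow> 'u::ab_group_add"
    and A :: "'u nspace \<Rightarrow> 'u nspace \<Rightarrow> ('u \<Rightarrow> 'u) set"
    and q :: "'u nspace \<Rightarrow> 'u nspace \<Rightarrow> ('u \<Rightarrow> 'u) \<Rightarrow> real"
    and X :: "'u nspace" +
  fixes b :: real
  assumes trace_bound: "u \<in> finite_rank_ops s X \<inter> A X X \<Longrightarrow> cmod (op_trace s X u) \<le> b * q X X u"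
begin

text \<open>
  The finite rank operators in the ideal, the function to be extended, and the quasimetric with
  respect to which it is to be extended.
\<close>

abbreviation FA :: "('u \<Rightarrow> 'u) set" where "FA \<equiv> finite_rank_ops s X \<inter> A X X"
abbreviation Det :: "('u \<Rightarrow> 'u) \<Rightarrow> complex" where "Det \<equiv> det_one_minus s X"
abbreviation dst :: "('u \<Rightarrow> 'u) \<Rightarrow> ('u \<Rightarrow> 'u) \<Rightarrow> real" where "dst u v \<equiv> q X X (\<lambda>x. u x - v x)"

lemma FA_diff: "u \<in> FA \<Longrightarrow> v \<in> FA \<Longrightarrow> (\<lambda>x. u x - v x) \<in> FA"
  using ideal_diff finite_rank_diff by auto

lemma det_exp_of_small:
  assumes w: "w \<in> FA" and qw: "q X X w \<le> 1/2"
  shows "\<exists>z. Det w = exp z \<and> cmod z \<le> 2 * \<bar>b\<bar> * q X X w"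
proof -
  have nonneg: "0 \<le> q X X w" using q_nonneg[OF banach banach] w by blast
  have contr: "nrm X (w x) \<le> (1/2) * nrm X x" if "x \<in> pts X" for x
  proof -
    have "nrm X (w x) \<le> q X X w * nrm X x" using norm_le_quasinorm w that by blast
    also have "\<dots> \<le> (1/2) * nrm X x" using qw that by (intro mult_right_mono) auto
    finally show ?thesis .
  qed
  have tr: "cmod (op_trace s X (w ^^ Suc k)) \<le> (\<bar>b\<bar> * q X X w) * (1/2) ^ k" for k
  proof -
    have p: "w ^^ Suc k \<in> A X X" "q X X (w ^^ Suc k) \<le> (1/2) ^ k * q X X w"
      using power_in_ideal[of w "1/2" k] w contr by auto
    have "w ^^ Suc k \<in> finite_rank_ops s X"
      using w funpow_finite_rank finite_rank_ops_iff by (metis IntD1)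
    then have "cmod (op_trace s X (w ^^ Suc k)) \<le> b * q X X (w ^^ Suc k)"
      using p by (intro trace_bound) simp
    also have "\<dots> \<le> \<bar>b\<bar> * q X X (w ^^ Suc k)"
      using q_nonneg[OF banach banach p(1)] by (intro mult_right_mono) auto
    also have "\<dots> \<le> \<bar>b\<bar> * ((1/2) ^ k * q X X w)" using p(2) by (intro mult_left_mono) auto
    finally show ?thesis by (simp add: mult_ac)
  qed
  show ?thesis
    using det_one_minus_exp[OF _ contr _ _ tr] w by (auto simp: mult_ac)
qed

lemma det_continuous_at_zero:
  assumes "e > 0"
  shows "\<exists>d>0. d \<le> 1/2 \<and> (\<forall>w\<in>FA. q X X w < d \<longrightarrow> cmod (Det w - 1) < e)"
proof -
  have "isCont exp (0::complex)" by simp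
  then obtain \<eta> where eta: "\<eta> > 0" "\<And>z::complex. cmod z < \<eta> \<Longrightarrow> cmod (exp z - 1) < e"
    using \<open>e > 0\<close> unfolding continuous_at_eps_delta dist_norm by (metis diff_zero exp_zero)
  define d where "d = min (1/2) (\<eta> / (2 * \<bar>b\<bar> + 1))"
  have d: "d > 0" using eta by (simp add: d_def)
  have d2: "d \<le> 1/2" unfolding d_def by (rule min.cobounded1)
  have "cmod (Det w - 1) < e" if w: "w \<in> FA" "q X X w < d" for w
  proof -
    obtain z where z: "Det w = exp z" "cmod z \<le> 2 * \<bar>b\<bar> * q X X w"
      using det_exp_of_small[OF w(1)] w(2) d2 by auto
    have q0: "0 \<le> q X X w" using q_nonneg[OF banach banach] w by blast
    have "cmod z \<le> (2 * \<bar>b\<bar> + 1) * q X X w" using z(2) q0 by (simp add: algebra_simps)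
    also have "\<dots> < (2 * \<bar>b\<bar> + 1) * (\<eta> / (2 * \<bar>b\<bar> + 1))"
      using w(2) by (intro mult_strict_left_mono) (auto simp: d_def)
    also have "\<dots> = \<eta>" by simp
    finally show ?thesis using eta(2) z(1) by simp
  qed
  then show ?thesis using d d2 by blast
qed

text \<open>
  The inverse of \<open>1 - g\<close> on the space, for \<open>g\<close> of quasinorm at most \<open>1/2\<close>. It has the value 0 outside
  the space, like all operators here.
\<close>

definition resolvent :: "('u \<Rightarrow> 'u) \<Rightarrow> 'u \<Rightarrow> 'u" where
  "resolvent g = (SOME B. B \<in> bounded_ops s X X \<and> (\<forall>x\<in>pts X. B x - g (B x) = x) \<and>
     (\<forall>x\<in>pts X. nrm X (B x) \<le> 2 * nrm X x))"

lemma small_contraction: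
  assumes "g \<in> A X X" "q X X g \<le> 1/2" "x \<in> pts X"
  shows "nrm X (g x) \<le> 1/2 * nrm X x"
  using norm_le_quasinorm[OF assms(1,3)] mult_right_mono[OF assms(2) nrm_nonneg[OF assms(3)]] by simp

lemma resolvent:
  assumes g: "g \<in> A X X" "q X X g \<le> 1/2"
  shows "resolvent g \<in> bounded_ops s X X"
    "x \<in> pts X \<Longrightarrow> resolvent g x - g (resolvent g x) = x"
    "x \<in> pts X \<Longrightarrow> nrm X (resolvent g x) \<le> 2 * nrm X x"
proof -
  obtain B where "B \<in> bounded_ops s X X" "\<And>x. x \<in> pts X \<Longrightarrow> B x - g (B x) = x"
      "\<And>x. x \<in> pts X \<Longrightarrow> nrm X (B x) \<le> nrm X x / (1 - 1/2)"
    using contraction_inverse[OF ideal_linear[OF g(1)] small_contraction[OF g]] by auto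
  then have "\<exists>B. B \<in> bounded_ops s X X \<and> (\<forall>x\<in>pts X. B x - g (B x) = x) \<and>
     (\<forall>x\<in>pts X. nrm X (B x) \<le> 2 * nrm X x)" by (intro exI[of _ B]) (auto simp: mult.commute)
  from someI_ex[OF this, folded resolvent_def]
  show "resolvent g \<in> bounded_ops s X X"
    "x \<in> pts X \<Longrightarrow> resolvent g x - g (resolvent g x) = x"
    "x \<in> pts X \<Longrightarrow> nrm X (resolvent g x) \<le> 2 * nrm X x" by auto
qed

text \<open>The factorisation \<open>1 - (g + v) = (1 - g) (1 - (1 - g)\<inverse> v)\<close>.\<close>

lemma det_perturb:
  assumes g: "g \<in> FA" "q X X g \<le> 1/2" and v: "v \<in> finite_rank_ops s X"
  shows "Det (\<lambda>x. g x + v x) = Det g * Det (resolvent g \<circ> v)"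
proof -
  have gA: "g \<in> A X X" using g by simp
  note B = resolvent[OF gA g(2)]
  have w: "resolvent g \<circ> v \<in> finite_rank_ops s X"
    using finite_rank_comp[OF bounded_ops_linear[OF B(1)] v] .
  have vX: "v x \<in> pts X" for x
    using v linear_on_pts_mem[OF finite_rank_linear[OF v]] rank_sum_outside finite_rank_ops_iff
    by (metis pts_zero)
  have "(\<lambda>x. g x + (resolvent g \<circ> v) x - g ((resolvent g \<circ> v) x)) = (\<lambda>x. g x + v x)"
    using B(2)[OF vX] by (simp add: fun_eq_iff algebra_simps)
  then show ?thesis using det_one_minus_mult[OF _ w, of g] g(1) by simp
qed

lemma det_diff_small:
  assumes g: "g \<in> FA" "q X X g \<le> 1/2" and h: "h \<in> FA"
  shows "\<exists>w\<in>FA. q X X w \<le> 2 * dst h g \<and> Det h = Det g * Det w"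
proof -
  have gA: "g \<in> A X X" using g by simp
  note B = resolvent[OF gA g(2)]
  have d: "(\<lambda>x. h x - g x) \<in> FA" using FA_diff h g(1) by blast
  define w where "w = resolvent g \<circ> (\<lambda>x. h x - g x)"
  have "Det h = Det g * Det w"
    using det_perturb[OF g, of "\<lambda>x. h x - g x"] d by (simp add: w_def)
  moreover have "w \<in> finite_rank_ops s X"
    unfolding w_def using finite_rank_comp[OF bounded_ops_linear[OF B(1)]] d by blast
  moreover have "w \<in> A X X" "q X X w \<le> 2 * dst h g"
    unfolding w_def using ideal_comp_left[OF B(1) B(3)] d by auto
  ultimately show ?thesis by blast
qed

end

section \<open>Dependence of a determinant on its entries\<close>

text \<open>Dividing by \<open>K\<close> reduces this to factors in the unit ball.\<close>

lemma norm_prod_diff_le: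
  fixes x y :: "'i \<Rightarrow> 'a :: real_normed_field" and K d :: real
  assumes K: "K \<ge> 1" and I: "finite I"
    and x: "\<And>i. i \<in> I \<Longrightarrow> norm (x i) \<le> K" and y: "\<And>i. i \<in> I \<Longrightarrow> norm (y i) \<le> K"
    and d: "\<And>i. i \<in> I \<Longrightarrow> norm (x i - y i) \<le> d"
  shows "norm (prod x I - prod y I) \<le> K ^ card I * (card I * d)"
proof -
  have scale: "prod f I = of_real (K ^ card I) * (\<Prod>i\<in>I. f i / of_real K)" for f :: "'i \<Rightarrow> 'a"
    using K by (simp add: prod_dividef)
  have "norm ((\<Prod>i\<in>I. x i / of_real K) - (\<Prod>i\<in>I. y i / of_real K))
      \<le> (\<Sum>i\<in>I. norm (x i / of_real K - y i / of_real K))"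
    using x y K by (intro norm_prod_diff) (auto simp: norm_divide)
  also have "\<dots> \<le> (\<Sum>i\<in>I. d)"
  proof (intro sum_mono)
    fix i assume i: "i \<in> I"
    have "norm (x i / of_real K - y i / of_real K) = norm (x i - y i) / K"
      using K by (simp add: norm_divide flip: diff_divide_distrib)
    also have "\<dots> \<le> norm (x i - y i) / 1" using K by (intro divide_left_mono) auto
    finally show "norm (x i / of_real K - y i / of_real K) \<le> d" using d[OF i] by simp
  qed
  finally have *: "norm ((\<Prod>i\<in>I. x i / of_real K) - (\<Prod>i\<in>I. y i / of_real K)) \<le> card I * d"
    by simp
  have "norm (prod x I - prod y I) =
      K ^ card I * norm ((\<Prod>i\<in>I. x i / of_real K) - (\<Prod>i\<in>I. y i / of_real K))"
    unfolding scale[of x] scale[of y] right_diff_distrib[symmetric] norm_mult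
    using K by (simp add: norm_power)
  also have "\<dots> \<le> K ^ card I * (card I * d)" using K * by (intro mult_left_mono) auto
  finally show ?thesis .
qed

lemma norm_det_le:
  fixes M :: "complex mat"
  assumes M: "M \<in> carrier_mat N N" and K: "\<And>i j. i < N \<Longrightarrow> j < N \<Longrightarrow> cmod (M $$ (i, j)) \<le> K"
  shows "cmod (det M) \<le> fact N * K ^ N"
proof -
  have "cmod (det M) \<le> (\<Sum>p | p permutes {0..<N}. K ^ N)"
    unfolding det_def'[OF M]
  proof (intro sum_norm_le)
    fix p assume "p \<in> {p. p permutes {0..<N}}"
    then have p: "p i < N" if "i < N" for i using that permutes_in_image[of p "{0..<N}" i] by auto
    have "(\<Prod>i = 0..<N. cmod (M $$ (i, p i))) \<le> (\<Prod>i = 0..<N. K)"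
      using K p by (intro prod_mono) auto
    then show "cmod (signof p * (\<Prod>i = 0..<N. M $$ (i, p i))) \<le> K ^ N"
      by (simp add: norm_mult sign_def prod_norm)
  qed
  then show ?thesis by (simp add: card_permutations[of "{0..<N}" N])
qed

lemma norm_det_diff_le:
  fixes M M' :: "complex mat" and K d :: real
  assumes M: "M \<in> carrier_mat N N" and M': "M' \<in> carrier_mat N N" and "K \<ge> 1"
    and K: "\<And>i j. i < N \<Longrightarrow> j < N \<Longrightarrow> cmod (M $$ (i, j)) \<le> K"
    and K': "\<And>i j. i < N \<Longrightarrow> j < N \<Longrightarrow> cmod (M' $$ (i, j)) \<le> K"
    and d: "\<And>i j. i < N \<Longrightarrow> j < N \<Longrightarrow> cmod (M $$ (i, j) - M' $$ (i, j)) \<le> d"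
  shows "cmod (det M - det M') \<le> fact N * (K ^ N * (N * d))"
proof -
  have "cmod (det M - det M') \<le> (\<Sum>p | p permutes {0..<N}. K ^ N * (N * d))"
    unfolding det_def'[OF M] det_def'[OF M'] sum_subtractf[symmetric]
  proof (intro sum_norm_le)
    fix p assume "p \<in> {p. p permutes {0..<N}}"
    then have p: "p i < N" if "i < N" for i using that permutes_in_image[of p "{0..<N}" i] by auto
    have "cmod ((\<Prod>i = 0..<N. M $$ (i, p i)) - (\<Prod>i = 0..<N. M' $$ (i, p i)))
        \<le> K ^ card {0..<N} * (card {0..<N} * d)"
      using p K K' d \<open>K \<ge> 1\<close> by (intro norm_prod_diff_le) auto
    then show "cmod (signof p * (\<Prod>i = 0..<N. M $$ (i, p i)) - signof p * (\<Prod>i = 0..<N. M' $$ (i, p i)))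
        \<le> K ^ N * (N * d)"
      by (simp add: norm_mult sign_def flip: right_diff_distrib)
  qed
  then show ?thesis by (simp add: card_permutations[of "{0..<N}" N])
qed

section \<open>The continuous extension\<close>

context ideal_with_trace
begin

text \<open>By the identity \<open>(1 - h) ((1 - h)\<inverse> - (1 - g)\<inverse>) = (h - g) (1 - g)\<inverse>\<close>.\<close>

lemma resolvent_diff:
  assumes g: "g \<in> A X X" "q X X g \<le> 1/2" and h: "h \<in> A X X" "q X X h \<le> 1/2" and x: "x \<in> pts X"
  shows "nrm X (resolvent h x - resolvent g x) \<le> 4 * dst h g * nrm X x"
proof -
  let ?y = "resolvent h x" and ?z = "resolvent g x"
  note lin = ideal_linear[OF h(1)] ideal_linear[OF g(1)]
  have y: "?y \<in> pts X" and z: "?z \<in> pts X"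
    using resolvent(1)[OF g] resolvent(1)[OF h] x linear_on_pts_mem bounded_ops_linear by blast+
  have eq: "(?y - ?z) - h (?y - ?z) = h ?z - g ?z"
  proof -
    have "?y - h ?y = ?z - g ?z"
      using resolvent(2)[OF g x] resolvent(2)[OF h x] by simp
    then show ?thesis by (simp add: linear_on_pts_diff[OF lin(1) y z] algebra_simps)
  qed
  have "nrm X (?y - ?z) \<le> nrm X (h ?z - g ?z) / (1 - 1/2)"
    using norm_le_of_contraction[OF lin(1) small_contraction[OF h], of "?y - ?z"] y z
    by (simp only: eq) simp
  also have "\<dots> = 2 * nrm X (h ?z - g ?z)" by simp
  also have "\<dots> \<le> 2 * (dst h g * nrm X ?z)"
    using norm_le_quasinorm[OF ideal_diff[OF h(1) g(1)] z] by (intro mult_left_mono) auto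
  also have "\<dots> \<le> 2 * (dst h g * (2 * nrm X x))"
    using resolvent(3)[OF g x] q_nonneg[OF banach banach ideal_diff[OF h(1) g(1)]]
    by (intro mult_left_mono) auto
  finally show ?thesis by simp
qed

lemma det_resolvent_lipschitz:
  assumes v: "v \<in> finite_rank_ops s X"
  obtains K where "K \<ge> 0"
    "\<And>g. g \<in> FA \<Longrightarrow> q X X g \<le> 1/2 \<Longrightarrow> cmod (Det (resolvent g \<circ> v)) \<le> K"
    "\<And>g h. g \<in> FA \<Longrightarrow> q X X g \<le> 1/2 \<Longrightarrow> h \<in> FA \<Longrightarrow> q X X h \<le> 1/2 \<Longrightarrow>
       cmod (Det (resolvent h \<circ> v) - Det (resolvent g \<circ> v)) \<le> K * dst h g"
proof -
  obtain N \<phi> a where sys: "system N \<phi> a" and v_eq: "v = rank_sum N \<phi> a"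
    using v unfolding finite_rank_ops_iff by blast
  have "\<forall>i. \<exists>B. B \<ge> 0 \<and> (i < N \<longrightarrow> (\<forall>x\<in>pts X. cmod (\<phi> i x) \<le> B * nrm X x))"
  proof
    fix i
    show "\<exists>B. B \<ge> 0 \<and> (i < N \<longrightarrow> (\<forall>x\<in>pts X. cmod (\<phi> i x) \<le> B * nrm X x))"
    proof (cases "i < N")
      case True
      show ?thesis by (rule dual_bound[OF systemD(1)[OF sys True]]) blast
    qed auto
  qed
  from choice[OF this] obtain B where B0: "\<And>i. B i \<ge> 0"
    and B: "\<And>i x. i < N \<Longrightarrow> x \<in> pts X \<Longrightarrow> cmod (\<phi> i x) \<le> B i * nrm X x" by blast
  define \<beta> where "\<beta> = (\<Sum>i<N. B i)"
  define \<alpha> where "\<alpha> = (\<Sum>j<N. nrm X (a j))"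
  have alpha: "nrm X (a j) \<le> \<alpha>" if "j < N" for j
    unfolding \<alpha>_def using that sys by (intro member_le_sum) (auto simp: system_def)
  have beta: "cmod (\<phi> i x) \<le> \<beta> * nrm X x" if "i < N" "x \<in> pts X" for i x
  proof -
    have "B i \<le> \<beta>" unfolding \<beta>_def using that B0 by (intro member_le_sum) auto
    then show ?thesis using B[OF that] that(2) by (meson mult_right_mono nrm_nonneg order_trans)
  qed
  have nonneg: "\<alpha> \<ge> 0" "\<beta> \<ge> 0"
    unfolding \<alpha>_def \<beta>_def using B0 sys by (auto intro!: sum_nonneg simp: system_def)
  define M where "M g = 1\<^sub>m N - system_matrix N \<phi> (\<lambda>k. resolvent g (a k))" for g
  define K1 where "K1 = 1 + \<beta> * (2 * \<alpha>)"
  have K1: "K1 \<ge> 1" using nonneg by (simp add: K1_def)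
  have M: "M g \<in> carrier_mat N N" for g
    unfolding M_def by (intro minus_carrier_mat system_matrix_carrier)
  have M_index: "M g $$ (i, j) = (if i = j then 1 else 0) - \<phi> i (resolvent g (a j))" if "i < N" "j < N" for g i j
    using that by (simp add: M_def system_matrix_def)
  have det: "Det (resolvent g \<circ> v) = det (M g)" if g: "g \<in> FA" "q X X g \<le> 1/2" for g
  proof -
    have lin: "linear_on_pts (resolvent g)" using resolvent(1)[of g] g bounded_ops_linear by blast
    show ?thesis
      unfolding v_eq comp_rank_sum(1)[OF lin sys] M_def
      by (rule det_one_minus_eq_det[OF comp_rank_sum(2)[OF lin sys]])
  qed
  have res_mem: "resolvent g (a j) \<in> pts X" if "g \<in> FA" "q X X g \<le> 1/2" "j < N" for g j
    using resolvent(1)[of g] that bounded_ops_linear linear_on_pts_mem systemD(2)[OF sys] by blast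
  have entry: "cmod (M g $$ (i, j)) \<le> K1" if g: "g \<in> FA" "q X X g \<le> 1/2" and ij: "i < N" "j < N" for g i j
  proof -
    have "cmod (\<phi> i (resolvent g (a j))) \<le> \<beta> * nrm X (resolvent g (a j))"
      using beta[OF ij(1) res_mem[OF g ij(2)]] .
    also have "\<dots> \<le> \<beta> * (2 * nrm X (a j))"
      using resolvent(3)[of g "a j"] g systemD(2)[OF sys ij(2)] nonneg by (intro mult_left_mono) auto
    also have "\<dots> \<le> \<beta> * (2 * \<alpha>)"
      using alpha[OF ij(2)] nonneg by (intro mult_left_mono) auto
    finally have "cmod (\<phi> i (resolvent g (a j))) \<le> \<beta> * (2 * \<alpha>)" .
    moreover have "cmod (M g $$ (i, j)) \<le> 1 + cmod (\<phi> i (resolvent g (a j)))"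
      unfolding M_index[OF ij]
      using norm_triangle_ineq4[of "if i = j then 1 else 0" "\<phi> i (resolvent g (a j))"] by (auto split: if_splits)
    ultimately show ?thesis by (simp add: K1_def)
  qed
  have entry_diff: "cmod (M h $$ (i, j) - M g $$ (i, j)) \<le> \<beta> * (4 * \<alpha>) * dst h g"
    if g: "g \<in> FA" "q X X g \<le> 1/2" and h: "h \<in> FA" "q X X h \<le> 1/2" and ij: "i < N" "j < N" for g h i j
  proof -
    have gh: "g \<in> A X X" "h \<in> A X X" using g h by auto
    have aj: "a j \<in> pts X" using systemD(2)[OF sys ij(2)] .
    have dnn: "0 \<le> dst h g" using q_nonneg[OF banach banach ideal_diff[OF gh(2,1)]] .
    have "M h $$ (i, j) - M g $$ (i, j) = - \<phi> i (resolvent h (a j) - resolvent g (a j))"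
      using res_mem[OF g ij(2)] res_mem[OF h ij(2)] dual_apply_diff[OF systemD(1)[OF sys ij(1)]]
      by (simp add: M_index[OF ij])
    then have "cmod (M h $$ (i, j) - M g $$ (i, j)) \<le> \<beta> * nrm X (resolvent h (a j) - resolvent g (a j))"
      using beta[OF ij(1) pts_diff[OF res_mem[OF h ij(2)] res_mem[OF g ij(2)]]] by simp
    also have "\<dots> \<le> \<beta> * (4 * dst h g * nrm X (a j))"
      using resolvent_diff[OF gh(1) g(2) gh(2) h(2) aj] nonneg by (intro mult_left_mono) auto
    also have "\<dots> \<le> \<beta> * (4 * dst h g * \<alpha>)"
      using alpha[OF ij(2)] nonneg dnn by (intro mult_left_mono) auto
    finally show ?thesis by (simp add: mult_ac)
  qed
  define K where "K = max (fact N * K1 ^ N) (fact N * (K1 ^ N * (N * (\<beta> * (4 * \<alpha>)))))"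
  have "K \<ge> 0" using K1 by (simp add: K_def le_max_iff_disj)
  moreover have "cmod (Det (resolvent g \<circ> v)) \<le> K" if g: "g \<in> FA" "q X X g \<le> 1/2" for g
  proof -
    have "cmod (det (M g)) \<le> fact N * K1 ^ N" using norm_det_le[OF M entry[OF g]] .
    then show ?thesis using det[OF g] by (simp add: K_def)
  qed
  moreover have "cmod (Det (resolvent h \<circ> v) - Det (resolvent g \<circ> v)) \<le> K * dst h g"
    if g: "g \<in> FA" "q X X g \<le> 1/2" and h: "h \<in> FA" "q X X h \<le> 1/2" for g h
  proof -
    have dnn: "0 \<le> dst h g" using q_nonneg[OF banach banach ideal_diff] g h by auto
    have "cmod (det (M h) - det (M g)) \<le> fact N * (K1 ^ N * (N * (\<beta> * (4 * \<alpha>) * dst h g)))"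
      using norm_det_diff_le[OF M M K1 entry[OF h] entry[OF g] entry_diff[OF g h]] .
    also have "\<dots> = (fact N * (K1 ^ N * (N * (\<beta> * (4 * \<alpha>))))) * dst h g" by (simp add: mult_ac)
    also have "\<dots> \<le> K * dst h g" using dnn by (intro mult_right_mono) (auto simp: K_def)
    finally show ?thesis using det[OF g] det[OF h] by simp
  qed
  ultimately show ?thesis using that by blast
qed

end

text \<open>In addition, the finite rank operators are dense.\<close>

locale ideal_with_dense_trace = ideal_with_trace s A q X b
  for s :: "complex \<Rightarrow> 'u \<Rightarrow> 'u::ab_group_add"
    and A :: "'u nspace \<Rightarrow> 'u nspace \<Rightarrow> ('u \<Rightarrow> 'u) set"
    and q :: "'u nspace \<Rightarrow> 'u nspace \<Rightarrow> ('u \<Rightarrow> 'u) \<Rightarrow> real"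
    and X :: "'u nspace"
    and b :: real +
  assumes dense: "u \<in> A X X \<Longrightarrow> e > 0 \<Longrightarrow> \<exists>v\<in>finite_rank_ops s X \<inter> A X X. q X X (\<lambda>x. u x - v x) < e"
begin

text \<open>
  The operators \<open>v\<close> and \<open>w\<close> are compared with a fixed finite rank operator \<open>v0\<close> so close to \<open>u\<close> that
  the differences \<open>h = v - v0\<close> and \<open>g = w - v0\<close> are small. The distance from \<open>h\<close> to \<open>g\<close>
  is that from \<open>v\<close> to \<open>w\<close>.
\<close>

lemma det_cauchy:
  assumes u: "u \<in> A X X" and e: "e > 0"
  shows "\<exists>d>0. \<forall>v\<in>FA. \<forall>w\<in>FA. dst v u < d \<longrightarrow> dst w u < d \<longrightarrow> cmod (Det v - Det w) < e"
proof -
  obtain C where C: "C > 0" and tri: "\<And>U V W. U \<in> A X X \<Longrightarrow> V \<in> A X X \<Longrightarrow> W \<in> A X X \<Longrightarrow>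
      dst U W \<le> C * (dst U V + dst V W)"
    using quasi_triangle by blast
  obtain \<delta> where \<delta>: "\<delta> > 0" "\<delta> \<le> 1/2" "\<And>w. w \<in> FA \<Longrightarrow> q X X w < \<delta> \<Longrightarrow> cmod (Det w - 1) < 1"
    using det_continuous_at_zero[of 1] by auto
  define \<rho> where "\<rho> = \<delta> / (2 * C)"
  have rho: "\<rho> > 0" "2 * C * \<rho> = \<delta>" using \<delta> C by (auto simp: \<rho>_def)
  obtain v0 where v0: "v0 \<in> FA" "dst u v0 < \<rho>" using dense[OF u rho(1)] by blast
  have v0A: "v0 \<in> A X X" using v0 by blast
  obtain K where K: "K \<ge> 0"
      "\<And>g. g \<in> FA \<Longrightarrow> q X X g \<le> 1/2 \<Longrightarrow> cmod (Det (resolvent g \<circ> v0)) \<le> K"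
      "\<And>g h. g \<in> FA \<Longrightarrow> q X X g \<le> 1/2 \<Longrightarrow> h \<in> FA \<Longrightarrow> q X X h \<le> 1/2 \<Longrightarrow>
       cmod (Det (resolvent h \<circ> v0) - Det (resolvent g \<circ> v0)) \<le> K * dst h g"
    using v0(1) by (rule det_resolvent_lipschitz[OF IntD1]) blast
  \<comment> \<open>Chosen so that the two terms of the final estimate add up to \<open>4 * e1 * K\<close>, which is less than \<open>e\<close>.\<close>
  define e1 where "e1 = e / (4 * (K + 1))"
  have e1: "e1 > 0" using e K(1) by (simp add: e1_def)
  obtain \<eta> where eta: "\<eta> > 0" "\<And>w. w \<in> FA \<Longrightarrow> q X X w < \<eta> \<Longrightarrow> cmod (Det w - 1) < e1"
    using det_continuous_at_zero[OF e1] by auto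
  define d where "d = min \<rho> (min (\<eta> / (4 * C)) (e1 / (2 * C)))"
  have d0: "d > 0" using rho eta C e1 by (simp add: d_def)
  have "d \<le> \<eta> / (4 * C)" "d \<le> e1 / (2 * C)" "d \<le> \<rho>" unfolding d_def by linarith+
  then have d: "4 * C * d \<le> \<eta>" "2 * C * d \<le> e1" "d \<le> \<rho>"
    using C by (auto simp: field_simps)
  have "cmod (Det v - Det w) < e"
    if v: "v \<in> FA" "dst v u < d" and w: "w \<in> FA" "dst w u < d" for v w
  proof -
    have vw: "v \<in> A X X" "w \<in> A X X" using v w by auto
    define h where "h = (\<lambda>x. v x - v0 x)"
    define g where "g = (\<lambda>x. w x - v0 x)"
    have small: "q X X (\<lambda>x. y x - v0 x) < \<delta>" if y: "y \<in> A X X" "dst y u < d" for y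
    proof -
      have "dst y v0 \<le> C * (dst y u + dst u v0)" by (rule tri[OF y(1) u v0A])
      also have "\<dots> < C * (\<rho> + \<rho>)" using C y(2) d(3) v0(2) by (intro mult_strict_left_mono) auto
      finally show ?thesis using rho by simp
    qed
    have h: "h \<in> FA" "q X X h < \<delta>" "q X X h \<le> 1/2"
      unfolding h_def using FA_diff[OF v(1) v0(1)] small[OF vw(1) v(2)] \<delta>(2) by auto
    have g: "g \<in> FA" "q X X g < \<delta>" "q X X g \<le> 1/2"
      unfolding g_def using FA_diff[OF w(1) v0(1)] small[OF vw(2) w(2)] \<delta>(2) by auto
    have hg: "dst h g < 2 * C * d"
    proof -
      have "dst h g = dst v w" by (simp add: h_def g_def)
      also have "\<dots> \<le> C * (dst v u + dst u w)" by (rule tri[OF vw(1) u vw(2)])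
      also have "\<dots> < C * (d + d)"
        using C v(2) w(2) q_diff_commute[OF u vw(2)] by (intro mult_strict_left_mono) auto
      finally show ?thesis by simp
    qed
    have Dv: "Det v = Det h * Det (resolvent h \<circ> v0)" and Dw: "Det w = Det g * Det (resolvent g \<circ> v0)"
      using det_perturb[OF h(1,3), of v0] det_perturb[OF g(1,3), of v0] v0(1) by (auto simp: h_def g_def)
    have Dg: "cmod (Det g) \<le> 2"
      using \<delta>(3)[OF g(1,2)] norm_triangle_ineq[of "Det g - 1" 1] by simp
    have Dhg: "cmod (Det h - Det g) \<le> 2 * e1"
    proof -
      obtain y where y: "y \<in> FA" "q X X y \<le> 2 * dst h g" "Det h = Det g * Det y"
        using det_diff_small[OF g(1,3) h(1)] by blast
      have "q X X y < \<eta>" using y(2) hg d(1) by simp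
      then have "cmod (Det y - 1) \<le> e1" using eta(2)[OF y(1)] by simp
      then have "cmod (Det g) * cmod (Det y - 1) \<le> 2 * e1" using Dg by (intro mult_mono) auto
      then show ?thesis by (simp add: y(3) algebra_simps flip: norm_mult)
    qed
    have "Det v - Det w = (Det h - Det g) * Det (resolvent h \<circ> v0)
        + Det g * (Det (resolvent h \<circ> v0) - Det (resolvent g \<circ> v0))"
      by (simp add: Dv Dw algebra_simps)
    then have "cmod (Det v - Det w) \<le> cmod (Det h - Det g) * cmod (Det (resolvent h \<circ> v0))
        + cmod (Det g) * cmod (Det (resolvent h \<circ> v0) - Det (resolvent g \<circ> v0))"
      using norm_triangle_ineq by (simp flip: norm_mult)
    also have "\<dots> \<le> 2 * e1 * K + 2 * (K * e1)"
    proof (intro add_mono mult_mono)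
      show "cmod (Det (resolvent h \<circ> v0) - Det (resolvent g \<circ> v0)) \<le> K * e1"
        using K(3)[OF g(1,3) h(1,3)] mult_left_mono[of "dst h g" e1 K] hg d(2) K(1) by linarith
    qed (use Dhg Dg K(1) K(2)[OF h(1,3)] e1 in auto)
    also have "\<dots> < e1 * (4 * (K + 1))"
      using e1 by (simp add: algebra_simps)
    also have "\<dots> = e"
    proof -
      have "e / (4 * k) * (4 * k) = e" if "k > 0" for k using that by simp
      from this[of "K + 1"] show ?thesis using K(1) by (simp only: e1_def)
    qed
    finally show ?thesis .
  qed
  then show ?thesis using d0 by blast
qed

text \<open>The Cauchy condition and density give a limit at every point of the ideal.\<close>

lemma det_limit:
  assumes u: "u \<in> A X X"
  shows "\<exists>L. \<forall>e>0. \<exists>d>0. \<forall>v\<in>FA. dst v u < d \<longrightarrow> cmod (Det v - L) < e"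
proof -
  have "\<forall>n. \<exists>v. v \<in> FA \<and> dst u v < inverse (real (Suc n))"
  proof
    fix n
    have "inverse (real (Suc n)) > 0" by simp
    from dense[OF u this] show "\<exists>v. v \<in> FA \<and> dst u v < inverse (real (Suc n))" by blast
  qed
  from choice[OF this] obtain v where v: "\<And>n. v n \<in> FA" "\<And>n. dst u (v n) < inverse (real (Suc n))"
    by blast
  have small: "\<exists>M. \<forall>n\<ge>M. dst (v n) u < d" if d: "d > 0" for d
  proof -
    obtain M where M: "inverse (real (Suc M)) < d" using reals_Archimedean[OF d] by blast
    have "dst (v n) u < d" if "n \<ge> M" for n
    proof -
      have "dst (v n) u = dst u (v n)" using v(1) u by (intro q_diff_commute) auto
      also have "\<dots> < inverse (real (Suc n))" by (rule v(2))
      also have "\<dots> \<le> inverse (real (Suc M))" using that by (intro le_imp_inverse_le) auto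
      finally show ?thesis using M by simp
    qed
    then show ?thesis by blast
  qed
  have "Cauchy (\<lambda>n. Det (v n))"
  proof (rule CauchyI)
    fix e :: real assume "e > 0"
    then obtain d where d: "d > 0" "\<forall>v\<in>FA. \<forall>w\<in>FA. dst v u < d \<longrightarrow> dst w u < d \<longrightarrow> cmod (Det v - Det w) < e"
      using det_cauchy[OF u] by blast
    obtain M where "\<forall>n\<ge>M. dst (v n) u < d" using small[OF d(1)] by blast
    then show "\<exists>M. \<forall>m\<ge>M. \<forall>n\<ge>M. norm (Det (v m) - Det (v n)) < e"
      using d(2) v(1) by (intro exI[of _ M]) auto
  qed
  then obtain L where L: "(\<lambda>n. Det (v n)) \<longlonglongrightarrow> L" using Cauchy_convergent convergent_def by blast
  have "\<exists>d>0. \<forall>w\<in>FA. dst w u < d \<longrightarrow> cmod (Det w - L) < e" if e: "e > 0" for e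
  proof -
    have "e / 2 > 0" using e by simp
    then obtain d where d: "d > 0" "\<And>v w. v \<in> FA \<Longrightarrow> w \<in> FA \<Longrightarrow> dst v u < d \<Longrightarrow> dst w u < d \<Longrightarrow>
        cmod (Det v - Det w) < e / 2"
      using det_cauchy[OF u] by blast
    obtain M where M: "\<And>n. n \<ge> M \<Longrightarrow> dst (v n) u < d" using small[OF d(1)] by blast
    have "cmod (Det w - L) < e" if w: "w \<in> FA" "dst w u < d" for w
    proof -
      have "(\<lambda>n. cmod (Det w - Det (v n))) \<longlonglongrightarrow> cmod (Det w - L)"
        by (intro tendsto_intros L)
      then have "cmod (Det w - L) \<le> e / 2"
        by (rule LIMSEQ_le_const2) (use d(2)[OF w(1) v(1) w(2) M] in \<open>blast intro: less_imp_le\<close>)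
      then show ?thesis using e by simp
    qed
    then show ?thesis using d(1) by blast
  qed
  then show ?thesis by blast
qed

lemma det_extends_continuously:
  "\<exists>D :: ('u \<Rightarrow> 'u) \<Rightarrow> complex. (\<forall>u\<in>FA. D u = Det u) \<and>
    (\<forall>u\<in>A X X. \<forall>e>0. \<exists>d>0. \<forall>v\<in>A X X. dst v u < d \<longrightarrow> cmod (D v - D u) < e)"
proof -
  obtain C where C: "C > 0" and tri: "\<And>U V W. U \<in> A X X \<Longrightarrow> V \<in> A X X \<Longrightarrow> W \<in> A X X \<Longrightarrow>
      dst U W \<le> C * (dst U V + dst V W)"
    using quasi_triangle by blast
  from bchoice[of "A X X" "\<lambda>u L. \<forall>e>0. \<exists>d>0. \<forall>v\<in>FA. dst v u < d \<longrightarrow> cmod (Det v - L) < e"] det_limit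
  obtain D where D: "\<And>u e. u \<in> A X X \<Longrightarrow> e > 0 \<Longrightarrow> \<exists>d>0. \<forall>v\<in>FA. dst v u < d \<longrightarrow> cmod (Det v - D u) < e"
    by blast
  have "D u = Det u" if u: "u \<in> FA" for u
  proof (rule ccontr)
    assume "D u \<noteq> Det u"
    then have "cmod (Det u - D u) > 0" by simp
    with D obtain d where "d > 0" "\<forall>v\<in>FA. dst v u < d \<longrightarrow> cmod (Det v - D u) < cmod (Det u - D u)"
      using u by blast
    moreover have "dst u u = 0"
      using q_eq_0_iff[OF banach banach ideal_zero[OF banach banach]] by simp
    ultimately show False using u by force
  qed
  moreover have "\<exists>d>0. \<forall>v\<in>A X X. dst v u < d \<longrightarrow> cmod (D v - D u) < e" if u: "u \<in> A X X" and e: "e > 0" for u e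
  proof -
    have e2: "e / 2 > 0" using e by simp
    obtain d where d: "d > 0" "\<And>v. v \<in> FA \<Longrightarrow> dst v u < d \<Longrightarrow> cmod (Det v - D u) < e / 2"
      using D[OF u e2] by blast
    define \<rho> where "\<rho> = d / (2 * C)"
    have rho: "\<rho> > 0" "C * (\<rho> + \<rho>) = d" using d C by (auto simp: \<rho>_def)
    have "cmod (D v - D u) < e" if v: "v \<in> A X X" "dst v u < \<rho>" for v
    proof -
      obtain d' where d': "d' > 0" "\<And>w. w \<in> FA \<Longrightarrow> dst w v < d' \<Longrightarrow> cmod (Det w - D v) < e / 2"
        using D[OF v(1) e2] by blast
      have "min d' \<rho> > 0" using d' rho by simp
      then obtain w where w: "w \<in> FA" "dst v w < min d' \<rho>" using dense[OF v(1)] by blast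
      have wA: "w \<in> A X X" using w by blast
      have wv: "dst w v < d'" "dst w v < \<rho>" using w(2) q_diff_commute[OF v(1) wA] by auto
      have "dst w u \<le> C * (dst w v + dst v u)" by (rule tri[OF wA v(1) u])
      also have "\<dots> < C * (\<rho> + \<rho>)" using C wv(2) v(2) by (intro mult_strict_left_mono) auto
      finally have "cmod (Det w - D u) < e / 2" using d(2)[OF w(1)] rho(2) by simp
      moreover have "cmod (Det w - D v) < e / 2" using d'(2)[OF w(1) wv(1)] .
      ultimately show ?thesis
        using norm_triangle_ineq4[of "Det w - D u" "Det w - D v"] by simp
    qed
    then show ?thesis using rho(1) by blast
  qed
  ultimately show ?thesis by blast
qed

end

theorem mainTheorem4:
  fixes s :: "complex \<Rightarrow> 'u \<Rightarrow> 'u::ab_group_add"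
    and A :: "'u nspace \<Rightarrow> 'u nspace \<Rightarrow> ('u \<Rightarrow> 'u) set"
    and q :: "'u nspace \<Rightarrow> 'u nspace \<Rightarrow> ('u \<Rightarrow> 'u) \<Rightarrow> real"
    and X :: "'u nspace"
  assumes ideal: "quasinormed_operator_ideal s A q"
    and banach: "banach_space s X"
    and dense: "\<forall>u\<in>A X X. \<forall>e>0. \<exists>v\<in>finite_rank_ops s X \<inter> A X X. q X X (\<lambda>x. u x - v x) < e"
    and trace_bounded:
      "\<exists>b. \<forall>u\<in>finite_rank_ops s X \<inter> A X X. cmod (op_trace s X u) \<le> b * q X X u"
  shows "\<exists>D :: ('u \<Rightarrow> 'u) \<Rightarrow> complex.
    (\<forall>u\<in>finite_rank_ops s X \<inter> A X X. D u = det_one_minus s X u) \<and>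
    (\<forall>u\<in>A X X. \<forall>e>0. \<exists>d>0. \<forall>v\<in>A X X. q X X (\<lambda>x. v x - u x) < d \<longrightarrow> cmod (D v - D u) < e)"
proof -
  obtain b where b: "\<And>u. u \<in> finite_rank_ops s X \<inter> A X X \<Longrightarrow> cmod (op_trace s X u) \<le> b * q X X u"
    using trace_bounded by blast
  interpret quasinormed_operator_ideal s A q by (rule ideal)
  interpret ideal_with_dense_trace s A q X b
    using banach dense b by unfold_locales auto
  show ?thesis by (rule det_extends_continuously)
qed

end
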